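(* Let $\{t_n\}$ be an infinite sequence of pairwise distinct nonzero real numbers with $|t_n|\to\infty$. (i) If $\{t_n\}$ is removable, then for any finite set $\{\tilde t_m\}_{m=1}^M$ of nonzero real numbers disjoint with $\{t_n\}$, the spectrum $\{t_n\}\cup\{\tilde t_m\}_{m=1}^M$ is removable. (ii) If the spectrum $\{t_n\}$ is removable, then by deleting a finite number of elements of this sequence and adding the same number of other elements (pairwise distinct nonzero real numbers not belonging to $\{t_n\}$) one always obtains a removable spectrum.
   Context: Removable spectra. Let $\{t_n\}$ be an infinite sequence of pairwise distinct nonzero real numbers with $|t_n|\to\infty$, let $\mu=\sum_n\mu_n\delta_{t_n}$ with masses $\mu_n>0$, and let $\mathcal{A}$ be the selfadjoint operator of multiplication by the independent variable $x$ in $L^2(\mu)$ with its natural domain $\mathcal{D}(\mathcal{A})=\{f\in L^2(\mu): xf\in L^2(\mu)\}$; $\mathcal{A}^{-1}$ is bounded. Let $a,b$ be functions with $a/x,\ b/x\in L^2(\mu)$ (possibly $a,b\notin L^2(\mu)$) and let $\varkappa\in\mathbb{C}$ be such that $\varkappa\neq\int_{\mathbb{R}}x^{-1}a(x)\overline{b(x)}\,d\mu(x)$ in the case when $a\in L^2(\mu)$ (no condition on $\varkappa$ if $a\notin L^2(\mu)$). The singular rank one perturbation $\mathcal{L}=\mathcal{L}(\mathcal{A},a,b,\varkappa)$ of $\mathcal{A}$ is the operator in $L^2(\mu)$ defined by $$\mathcal{D}(\mathcal{L})=\{y=y_0+c\cdot\mathcal{A}^{-1}a:\ c\in\mathbb{C},\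 y_0\in\mathcal{D}(\mathcal{A}),\ \varkappa c+\langle y_0,b\rangle=0\},\qquad \mathcal{L}y=\mathcal{A}y_0,$$ where $\mathcal{A}^{-1}a$ denotes the function $a/x$ and $\langle y_0,b\rangle=\int y_0\overline{b}\,d\mu$. (The condition on $\varkappa$ makes the decomposition of $y$ unique.) The spectrum $\{t_n\}$ is called removable if there exists a singular rank one perturbation $\mathcal{L}(\mathcal{A},a,b,\varkappa)$ of $\mathcal{A}$ whose spectrum is empty. This property does not depend on the choice of the masses $\mu_n>0$. *)

theory Defs
  imports "HOL-Analysis.Analysis"
begin

text \<open>The Borel measure \<open>\<mu> = (\<Sum>t\<in>T. m t \<cdot> \<delta>\<^sub>t)\<close> on the real line; values of \<open>m\<close> outside \<open>T\<close>
  are irrelevant.\<close>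

definition atomic_measure :: "real set \<Rightarrow> (real \<Rightarrow> real) \<Rightarrow> real measure" where
  "atomic_measure T m = distr (point_measure T (\<lambda>t. ennreal (m t))) borel (\<lambda>t. t)"

lemma emeasure_atomic_measure:
  assumes "B \<in> sets borel"
  shows "emeasure (atomic_measure T m) B
    = (\<integral>\<^sup>+ t. ennreal (m t) * indicator B t \<partial>count_space T)"
proof -
  have "emeasure (atomic_measure T m) B = emeasure (point_measure T (\<lambda>t. ennreal (m t))) (B \<inter> T)"
    unfolding atomic_measure_def using assms
    by (subst emeasure_distr) (auto simp: space_point_measure point_measure_def)
  also have "\<dots> = (\<integral>\<^sup>+ t. ennreal (m t) * indicator (B \<inter> T) t \<partial>count_space T)"
    by (simp add: point_measure_def emeasure_density)
  also have "\<dots> = (\<integral>\<^sup>+ t. ennreal (m t) * indicator B t \<partial>count_space T)"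
    by (rule nn_integral_cong) (auto simp: indicator_def)
  finally show ?thesis .
qed

text \<open>Elements of \<open>L\<^sup>2(M)\<close> are represented by square integrable functions; equality in
  \<open>L\<^sup>2(M)\<close> is equality almost everywhere.\<close>

definition L2_space :: "'a measure \<Rightarrow> ('a \<Rightarrow> complex) set" where
  "L2_space M = {f \<in> borel_measurable M. integrable M (\<lambda>x. (norm (f x))\<^sup>2)}"

definition L2_norm :: "'a measure \<Rightarrow> ('a \<Rightarrow> complex) \<Rightarrow> real" where
  "L2_norm M f = sqrt (\<integral>x. (norm (f x))\<^sup>2 \<partial>M)"

definition pairing :: "'a measure \<Rightarrow> ('a \<Rightarrow> complex) \<Rightarrow> ('a \<Rightarrow> complex) \<Rightarrow> complex" where
  "pairing M f g = (\<integral>x. f x * cnj (g x) \<partial>M)"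

text \<open>An operator in \<open>L\<^sup>2(M)\<close> is given by its graph, a set of pairs (argument, value) closed
  under almost everywhere equality.  A number \<open>z\<close> is in the resolvent set iff \<open>L - z\<close> maps the
  domain of \<open>L\<close> bijectively onto \<open>L\<^sup>2(M)\<close> with bounded inverse.\<close>

definition resolvent_set ::
    "'a measure \<Rightarrow> (('a \<Rightarrow> complex) \<times> ('a \<Rightarrow> complex)) set \<Rightarrow> complex set" where
  "resolvent_set M L = {z.
     (\<forall>(y, h)\<in>L. \<forall>(y', h')\<in>L.
        (AE x in M. h x - z * y x = h' x - z * y' x) \<longrightarrow> (AE x in M. y x = y' x)) \<and>
     (\<forall>g\<in>L2_space M. \<exists>(y, h)\<in>L. AE x in M. h x - z * y x = g x) \<and>
     (\<exists>C. \<forall>(y, h)\<in>L. L2_norm M y \<le> C * L2_norm M (\<lambda>x. h x - z * y x))}"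

definition spectrum ::
    "'a measure \<Rightarrow> (('a \<Rightarrow> complex) \<times> ('a \<Rightarrow> complex)) set \<Rightarrow> complex set" where
  "spectrum M L = - resolvent_set M L"

text \<open>Domain of the operator \<open>\<A>\<close> of multiplication by the independent variable.\<close>

definition mult_domain :: "real measure \<Rightarrow> (real \<Rightarrow> complex) set" where
  "mult_domain M = {f \<in> L2_space M. (\<lambda>x. of_real x * f x) \<in> L2_space M}"

text \<open>Admissible data \<open>(a, b, \<kappa>)\<close>, where \<open>a\<close> and \<open>b\<close> themselves need not be in \<open>L\<^sup>2(M)\<close>.\<close>

definition perturbation_data ::
    "real measure \<Rightarrow> (real \<Rightarrow> complex) \<Rightarrow> (real \<Rightarrow> complex) \<Rightarrow> complex \<Rightarrow> bool" where
  "perturbation_data M a b \<kappa> \<longleftrightarrow>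
     (\<lambda>x. a x / of_real x) \<in> L2_space M \<and>
     (\<lambda>x. b x / of_real x) \<in> L2_space M \<and>
     (a \<in> L2_space M \<longrightarrow> \<kappa> \<noteq> (\<integral>x. inverse (of_real x) * a x * cnj (b x) \<partial>M))"

text \<open>Graph of the singular rank one perturbation \<open>\<L>(\<A>, a, b, \<kappa>)\<close>.\<close>

definition singular_perturbation ::
    "real measure \<Rightarrow> (real \<Rightarrow> complex) \<Rightarrow> (real \<Rightarrow> complex) \<Rightarrow> complex
      \<Rightarrow> ((real \<Rightarrow> complex) \<times> (real \<Rightarrow> complex)) set" where
  "singular_perturbation M a b \<kappa> = {(y, h).
     y \<in> L2_space M \<and> h \<in> L2_space M \<and>
     (\<exists>c. \<exists>y0\<in>mult_domain M.
        \<kappa> * c + pairing M y0 b = 0 \<and>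
        (AE x in M. y x = y0 x + c * (a x / of_real x)) \<and>
        (AE x in M. h x = of_real x * y0 x))}"

text \<open>Removability of the spectrum \<open>T\<close>, for the given masses \<open>m\<close>.\<close>

definition removable :: "real set \<Rightarrow> (real \<Rightarrow> real) \<Rightarrow> bool" where
  "removable T m \<longleftrightarrow> (\<exists>a b \<kappa>. perturbation_data (atomic_measure T m) a b \<kappa> \<and>
     spectrum (atomic_measure T m) (singular_perturbation (atomic_measure T m) a b \<kappa>) = {})"

end

theory Submission
  imports Defs
begin

text \<open>Let \<open>c t = m t * a t * cnj (b t)\<close>.  The equation \<open>(L - z) y = g\<close> for a perturbation
\<open>L\<close> with data \<open>a, b, \<kappa>\<close> has the solution \<open>y = (g + C * a) / (x - z)\<close>, where the scalar
\<open>C\<close> has to satisfy one linear equation, whose coefficient at \<open>C\<close> is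

  \<open>G z = \<kappa> + (\<Sum>t\<in>T. c t * (1 / (t - z) - 1 / t))\<close>.

So a point \<open>z\<close> off \<open>T\<close> lies in the spectrum exactly if \<open>G z = 0\<close>.  At a point \<open>s\<close> of \<open>T\<close> the
equation loses the unknown \<open>y s\<close> and instead prescribes \<open>C * a s = - g s\<close>, while the linear
condition then has to determine the lost unknown with coefficient \<open>m s * cnj (b s)\<close>; this works
exactly if \<open>a s\<close> and \<open>b s\<close> are nonzero.  Hence the spectrum is empty if and only if \<open>G\<close> has a
pole at every point of \<open>T\<close> and no zero.

Conversely, every series \<open>G\<close> with these properties and with \<open>\<Sum> \<bar>c t\<bar> / t\<^sup>2 < \<infinity>\<close> comes from some
perturbation: the coefficients can be split into two factors \<open>a\<close> and \<open>b\<close> of the required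
integrability, and the splitting can be arranged so that \<open>a\<close> is not square integrable, in which
case no condition is imposed on \<open>\<kappa>\<close>.  The outcome is the criterion
\<open>removable_iff_admits_zero_free_series\<close>, which does not mention the masses.

With the criterion the theorem becomes an operation on \<open>G\<close>, which is the reciprocal of an entire
function with zero set \<open>T\<close>.  A new point \<open>s\<close> is added by passing to \<open>G z / (z - s)\<close>, and a point
\<open>d\<close> is exchanged for \<open>s\<close> by passing to \<open>G z * (z - d) / (z - s)\<close>.  Both factors have the form
\<open>\<alpha> + \<beta> / (z - s)\<close>, and partial fractions show in \<open>pole_series_times_moebius\<close> that the product with
such a factor is again a series of the same kind.  The theorem then follows by induction on the number
of points.\<close>

section \<open>Discrete sets of real numbers\<close>

locale discrete_spectrum =
  fixes T :: "real set"
  assumes infinite_T: "infinite T"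
    and nonzero_T: "0 \<notin> T"
    and finite_bounded_part: "\<And>R. finite {t \<in> T. \<bar>t\<bar> \<le> R}"
begin

lemma countable_T: "countable T"
proof -
  have "T = (\<Union>n::nat. {t \<in> T. \<bar>t\<bar> \<le> real n})"
    using real_arch_simple by auto
  also have "countable \<dots>"
    using finite_bounded_part by (auto intro: countable_finite)
  finally show ?thesis .
qed

lemma ex_large: "\<exists>t\<in>T. R < \<bar>t\<bar>"
proof (rule ccontr)
  assume "\<not> ?thesis"
  then have "T = {t \<in> T. \<bar>t\<bar> \<le> R}"
    by (auto simp: not_less)
  then show False
    using finite_bounded_part[of R] infinite_T by simp
qed

text \<open>Only finitely many points of \<open>T\<close> have distance less than 1 from \<open>z\<close>; if \<open>z\<close> is one of them, its
own term is \<open>1 / 0 = 0\<close>.\<close>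

lemma bounded_resolvent_factor: "\<exists>K\<ge>0. \<forall>t\<in>T. norm (1 / (of_real t - z :: complex)) \<le> K"
proof -
  let ?F = "{t \<in> T. \<bar>t\<bar> \<le> norm z + 1}"
  let ?f = "\<lambda>t. norm (1 / (of_real t - z :: complex))"
  let ?K = "Max (insert 1 (?f ` ?F))"
  have fin: "finite (insert 1 (?f ` ?F))"
    using finite_bounded_part by simp
  have "?f t \<le> ?K" if "t \<in> T" for t
  proof (cases "t \<in> ?F")
    case True
    then show ?thesis using fin by (intro Max_ge) auto
  next
    case False
    then have "norm z + 1 < \<bar>t\<bar>" using that by auto
    moreover have "\<bar>t\<bar> \<le> norm (of_real t - z) + norm z"
      using norm_triangle_sub[of "of_real t" z] by simp
    ultimately have "1 \<le> norm (of_real t - z)" by linarith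
    then have "?f t \<le> 1" by (simp add: norm_divide divide_le_eq)
    also have "1 \<le> ?K" using fin by (intro Max_ge) auto
    finally show ?thesis .
  qed
  moreover have "1 \<le> ?K" using fin by (intro Max_ge) auto
  ultimately show ?thesis by (intro exI[of _ ?K]) auto
qed

lemma bounded_multiplier: "\<exists>K\<ge>0. \<forall>t\<in>T. norm (of_real t / (of_real t - z :: complex)) \<le> K"
proof -
  obtain K where K: "K \<ge> 0" "\<And>t. t \<in> T \<Longrightarrow> norm (1 / (of_real t - z)) \<le> K"
    using bounded_resolvent_factor[of z] by auto
  have "norm (of_real t / (of_real t - z)) \<le> 1 + norm z * K" if "t \<in> T" for t
  proof (cases "of_real t = z")
    case False
    then have "of_real t / (of_real t - z) = 1 + z * (1 / (of_real t - z))"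
      by (simp add: field_simps)
    also have "norm \<dots> \<le> 1 + norm z * norm (1 / (of_real t - z))"
      by (metis norm_mult norm_one norm_triangle_ineq)
    also have "\<dots> \<le> 1 + norm z * K"
      using K(2)[OF that] by (intro add_left_mono mult_left_mono) auto
    finally show ?thesis .
  qed (use K in auto)
  then show ?thesis using K(1) by (intro exI[of _ "1 + norm z * K"]) auto
qed

text \<open>Adding the indicator function of such a subset to a nonnegative weight destroys its summability over \<open>T\<close> but
keeps it summable after division by \<open>t\<^sup>2\<close>; this is how a factor \<open>a\<close> outside \<open>L\<^sup>2\<close> is produced.\<close>

lemma ex_sparse_subset:
  "\<exists>N\<subseteq>T. infinite N \<and> (\<lambda>t. 1 / t\<^sup>2) summable_on N"
proof -
  have "\<exists>f. \<forall>n::nat. (f n \<in> T \<and> 2 ^ n \<le> \<bar>f n\<bar>) \<and> \<bar>f n\<bar> < \<bar>f (Suc n)\<bar>"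
  proof (rule dependent_nat_choice)
    show "\<exists>x. x \<in> T \<and> 2 ^ 0 \<le> \<bar>x\<bar>"
      using ex_large[of 1] by (auto intro: less_imp_le)
    fix x and n :: nat
    obtain y where "y \<in> T" "max (2 ^ Suc n) \<bar>x\<bar> < \<bar>y\<bar>"
      using ex_large by blast
    then show "\<exists>y. (y \<in> T \<and> 2 ^ Suc n \<le> \<bar>y\<bar>) \<and> \<bar>x\<bar> < \<bar>y\<bar>"
      by (intro exI[of _ y]) auto
  qed
  then obtain f where f_all: "\<forall>n::nat. (f n \<in> T \<and> 2 ^ n \<le> \<bar>f n\<bar>) \<and> \<bar>f n\<bar> < \<bar>f (Suc n)\<bar>" ..
  then have f: "\<And>n. f n \<in> T" "\<And>n. 2 ^ n \<le> \<bar>f n\<bar>" "\<And>n. \<bar>f n\<bar> < \<bar>f (Suc n)\<bar>"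
    by simp_all
  have "strict_mono (\<lambda>n. \<bar>f n\<bar>)"
    unfolding strict_mono_Suc_iff using f(3) by blast
  then have inj: "inj f"
    unfolding inj_def by (metis strict_mono_eq)
  have "summable (\<lambda>n. norm (1 / (f n)\<^sup>2))"
  proof (rule summable_comparison_test')
    show "summable (\<lambda>n. (1 / 4 :: real) ^ n)"
      by (simp add: summable_geometric)
    fix n :: nat
    have "(4::real) ^ n = (2 ^ n)\<^sup>2"
      by (simp add: power2_eq_square flip: power_mult_distrib)
    also have "\<dots> \<le> (f n)\<^sup>2"
      using f(2)[of n] power_mono[of "2 ^ n" "\<bar>f n\<bar>" 2] by simp
    finally have "4 ^ n \<le> (f n)\<^sup>2" .
    then show "norm (norm (1 / (f n)\<^sup>2)) \<le> (1 / 4) ^ n"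
      by (simp add: power_one_over frac_le)
  qed
  then have "(\<lambda>n. 1 / (f n)\<^sup>2) summable_on UNIV"
    by (rule norm_summable_imp_summable_on)
  then have "(\<lambda>t. 1 / t\<^sup>2) summable_on range f"
    by (subst summable_on_reindex[OF inj]) (simp add: o_def)
  moreover have "infinite (range f)"
    using inj finite_imageD by blast
  ultimately show ?thesis
    using f(1) by (intro exI[of _ "range f"]) auto
qed

end

section \<open>Square integrable functions on an atomic measure\<close>

locale atomic_spectrum = discrete_spectrum +
  fixes m :: "real \<Rightarrow> real"
  assumes mass_pos: "\<And>t. t \<in> T \<Longrightarrow> 0 < m t"
begin

abbreviation "M \<equiv> atomic_measure T m"

lemma sets_M [simp, measurable_cong]: "sets M = sets borel"
  by (simp add: atomic_measure_def)

lemma space_M [simp]: "space M = UNIV"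
  by (simp add: atomic_measure_def)

lemma borel_measurable_M [simp]: "borel_measurable M = borel_measurable borel"
  by (rule measurable_cong_sets) simp_all

text \<open>Every point of \<open>T\<close> is an atom, and the complement of the countable set \<open>T\<close> is a null set.\<close>

lemma AE_M_iff: "(AE x in M. P x) \<longleftrightarrow> (\<forall>t\<in>T. P t)"
proof
  assume "AE x in M. P x"
  then obtain N where N: "{x \<in> space M. \<not> P x} \<subseteq> N" "emeasure M N = 0" "N \<in> sets M"
    by (rule AE_E)
  show "\<forall>t\<in>T. P t"
  proof (intro ballI, rule ccontr)
    fix t assume t: "t \<in> T" "\<not> P t"
    have "(\<integral>\<^sup>+ s. ennreal (m s) * indicator N s \<partial>count_space T) = 0"
      using N by (subst emeasure_atomic_measure[symmetric]) auto
    then have "AE s in count_space T. ennreal (m s) * indicator N s = 0"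
      by (simp add: nn_integral_0_iff_AE)
    then have "ennreal (m t) * indicator N t = 0"
      using t(1) by (simp add: AE_count_space)
    moreover have "t \<in> N" using N(1) t(2) by auto
    ultimately show False using mass_pos[OF t(1)] by (simp add: ennreal_eq_0_iff)
  qed
next
  assume P: "\<forall>t\<in>T. P t"
  have meas: "- T \<in> sets borel"
    by (rule borel_comp, rule sets.countable[OF _ countable_T]) simp
  have "emeasure M (- T) = (\<integral>\<^sup>+ t. ennreal (m t) * indicator (- T) t \<partial>count_space T)"
    using meas by (rule emeasure_atomic_measure)
  also have "\<dots> = (\<integral>\<^sup>+ t. 0 \<partial>count_space T)"
    by (rule nn_integral_cong) auto
  finally have "emeasure M (- T) = 0" by simp
  then show "AE x in M. P x"
    using P meas by (intro AE_I[of _ _ "- T"]) auto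
qed

lemma measurable_off_T:
  assumes "\<And>x. x \<notin> T \<Longrightarrow> f x = 0"
  shows "(f :: real \<Rightarrow> complex) \<in> borel_measurable borel"
  by (rule measurable_discrete_difference[where f = "\<lambda>_. 0" and X = T])
     (simp_all add: assms countable_T)

lemma integrable_M_iff:
  assumes "(f :: real \<Rightarrow> 'b :: {banach, second_countable_topology}) \<in> borel_measurable borel"
  shows "integrable M f \<longleftrightarrow> (\<lambda>t. norm (m t *\<^sub>R f t)) summable_on T"
proof -
  have "integrable M f \<longleftrightarrow> integrable (density (count_space T) (\<lambda>t. ennreal (m t))) f"
    unfolding atomic_measure_def point_measure_def
    using assms by (subst integrable_distr_eq) auto
  also have "\<dots> \<longleftrightarrow> integrable (count_space T) (\<lambda>t. m t *\<^sub>R f t)"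
    using mass_pos by (subst integrable_density) (auto simp: AE_count_space less_imp_le)
  finally show ?thesis
    by (simp only: abs_summable_equivalent Infinite_Set_Sum.abs_summable_on_def)
qed

lemma integral_M_eq:
  assumes "(f :: real \<Rightarrow> 'b :: {banach, second_countable_topology}) \<in> borel_measurable borel"
    and "(\<lambda>t. norm (m t *\<^sub>R f t)) summable_on T"
  shows "(\<integral>x. f x \<partial>M) = (\<Sum>\<^sub>\<infinity>t\<in>T. m t *\<^sub>R f t)"
proof -
  have "(\<integral>x. f x \<partial>M) = (\<integral>x. f x \<partial>density (count_space T) (\<lambda>t. ennreal (m t)))"
    unfolding atomic_measure_def point_measure_def
    using assms(1) by (subst integral_distr) auto
  also have "\<dots> = (\<integral>t. m t *\<^sub>R f t \<partial>count_space T)"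
    using mass_pos by (subst integral_density) (auto simp: AE_count_space less_imp_le)
  also have "\<dots> = (\<Sum>\<^sub>\<infinity>t\<in>T. m t *\<^sub>R f t)"
    using infsetsum_infsum[of "\<lambda>t. m t *\<^sub>R f t" T] assms(2)
    by (simp only: infsetsum_def abs_summable_equivalent)
  finally show ?thesis .
qed

text \<open>Square summability and the norm of \<open>L\<^sup>2(M)\<close>, freed from measurability: only the values on \<open>T\<close>
enter, and each function on \<open>T\<close> extends by zero to a measurable one.\<close>

definition sq_summable :: "(real \<Rightarrow> complex) \<Rightarrow> bool" where
  "sq_summable f \<longleftrightarrow> (\<lambda>t. m t * (norm (f t))\<^sup>2) summable_on T"

definition norm2 :: "(real \<Rightarrow> complex) \<Rightarrow> real" where
  "norm2 f = sqrt (\<Sum>\<^sub>\<infinity>t\<in>T. m t * (norm (f t))\<^sup>2)"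

lemma L2_iff: "f \<in> L2_space M \<longleftrightarrow> f \<in> borel_measurable borel \<and> sq_summable f"
proof (cases "f \<in> borel_measurable borel")
  case True
  have "integrable M (\<lambda>x. (norm (f x))\<^sup>2) \<longleftrightarrow> (\<lambda>t. norm (m t * (norm (f t))\<^sup>2)) summable_on T"
    using True by (subst integrable_M_iff) auto
  also have "\<dots> \<longleftrightarrow> sq_summable f"
    unfolding sq_summable_def by (rule summable_on_iff_abs_summable_on_real[symmetric])
  finally show ?thesis
    using True by (simp add: L2_space_def)
qed (simp add: L2_space_def)

lemma L2_norm_eq:
  assumes "f \<in> L2_space M"
  shows "L2_norm M f = norm2 f"
proof -
  have [measurable]: "f \<in> borel_measurable borel" and "sq_summable f"
    using assms by (auto simp: L2_iff)
  from \<open>sq_summable f\<close> have "(\<lambda>t. norm (m t * (norm (f t))\<^sup>2)) summable_on T"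
    unfolding sq_summable_def by (rule summable_on_iff_abs_summable_on_real[THEN iffD1])
  then have "(\<integral>x. (norm (f x))\<^sup>2 \<partial>M) = (\<Sum>\<^sub>\<infinity>t\<in>T. m t * (norm (f t))\<^sup>2)"
    by (subst integral_M_eq) auto
  then show ?thesis by (simp add: L2_norm_def norm2_def)
qed

lemma norm2_nonneg: "0 \<le> norm2 f"
  unfolding norm2_def using mass_pos by (intro real_sqrt_ge_zero infsum_nonneg) (auto simp: less_imp_le)

lemma norm2_squared: "(norm2 f)\<^sup>2 = (\<Sum>\<^sub>\<infinity>t\<in>T. m t * (norm (f t))\<^sup>2)"
  unfolding norm2_def using mass_pos
  by (intro real_sqrt_pow2 infsum_nonneg) (auto simp: less_imp_le)

lemma norm2_cong: "(\<And>t. t \<in> T \<Longrightarrow> f t = g t) \<Longrightarrow> norm2 f = norm2 g"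
  unfolding norm2_def by (simp cong: infsum_cong)

lemma
  assumes f: "sq_summable f" and K: "0 \<le> K" and le: "\<And>t. t \<in> T \<Longrightarrow> norm (g t) \<le> K * norm (f t)"
  shows sq_summable_bound: "sq_summable g"
    and norm2_bound: "norm2 g \<le> K * norm2 f"
proof -
  have bound: "m t * (norm (g t))\<^sup>2 \<le> K\<^sup>2 * (m t * (norm (f t))\<^sup>2)" if t: "t \<in> T" for t
  proof -
    have "(norm (g t))\<^sup>2 \<le> (K * norm (f t))\<^sup>2"
      using le[OF t] by (intro power_mono) auto
    then have "m t * (norm (g t))\<^sup>2 \<le> m t * (K * norm (f t))\<^sup>2"
      using mass_pos[OF t] by (intro mult_left_mono) auto
    then show ?thesis by (simp add: power_mult_distrib mult_ac)
  qed
  have pos: "0 \<le> m t * (norm (g t))\<^sup>2" if "t \<in> T" for t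
    using mass_pos[OF that] by simp
  have sum: "(\<lambda>t. K\<^sup>2 * (m t * (norm (f t))\<^sup>2)) summable_on T"
    using f unfolding sq_summable_def by (rule summable_on_cmult_right)
  then have "(\<lambda>t. norm (m t * (norm (g t))\<^sup>2)) summable_on T"
    by (rule Infinite_Sum.abs_summable_on_comparison_test') (metis abs_of_nonneg bound pos real_norm_def)
  then show g: "sq_summable g"
    unfolding sq_summable_def by (rule summable_on_iff_abs_summable_on_real[THEN iffD2])
  have "(norm2 g)\<^sup>2 \<le> (K * norm2 f)\<^sup>2"
    unfolding power_mult_distrib norm2_squared
    using infsum_mono[OF _ sum bound] g f
    by (simp add: sq_summable_def infsum_cmult_right)
  then show "norm2 g \<le> K * norm2 f"
    by (rule power2_le_imp_le) (intro mult_nonneg_nonneg K norm2_nonneg)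
qed

text \<open>The factor 2 replaces the sharp triangle inequality by the termwise estimate
\<open>(u + v)\<^sup>2 \<le> 2 * u\<^sup>2 + 2 * v\<^sup>2\<close>; it is harmless, since the norm is only used to show that
operators are bounded.\<close>

lemma
  assumes f: "sq_summable f" and g: "sq_summable g"
  shows sq_summable_add: "sq_summable (\<lambda>t. f t + g t)"
    and norm2_add: "norm2 (\<lambda>t. f t + g t) \<le> 2 * (norm2 f + norm2 g)"
proof -
  have bound: "m t * (norm (f t + g t))\<^sup>2 \<le> 2 * (m t * (norm (f t))\<^sup>2) + 2 * (m t * (norm (g t))\<^sup>2)"
    if t: "t \<in> T" for t
  proof -
    have "(norm (f t + g t))\<^sup>2 \<le> (norm (f t) + norm (g t))\<^sup>2"
      by (intro power_mono norm_triangle_ineq) auto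
    also have "\<dots> \<le> 2 * (norm (f t))\<^sup>2 + 2 * (norm (g t))\<^sup>2"
      using sum_squares_bound[of "norm (f t)" "norm (g t)"] by (simp add: power2_sum)
    finally have "m t * (norm (f t + g t))\<^sup>2 \<le> m t * (2 * (norm (f t))\<^sup>2 + 2 * (norm (g t))\<^sup>2)"
      using mass_pos[OF t] by (intro mult_left_mono) auto
    then show ?thesis by (simp add: algebra_simps)
  qed
  have pos: "0 \<le> m t * (norm (f t + g t))\<^sup>2" if "t \<in> T" for t
    using mass_pos[OF that] by simp
  have sum: "(\<lambda>t. 2 * (m t * (norm (f t))\<^sup>2) + 2 * (m t * (norm (g t))\<^sup>2)) summable_on T"
    using f g unfolding sq_summable_def by (intro summable_on_add summable_on_cmult_right)
  then have "(\<lambda>t. norm (m t * (norm (f t + g t))\<^sup>2)) summable_on T"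
    by (rule Infinite_Sum.abs_summable_on_comparison_test') (metis abs_of_nonneg bound pos real_norm_def)
  then show fg: "sq_summable (\<lambda>t. f t + g t)"
    unfolding sq_summable_def by (rule summable_on_iff_abs_summable_on_real[THEN iffD2])
  have "(norm2 (\<lambda>t. f t + g t))\<^sup>2 \<le> 2 * (norm2 f)\<^sup>2 + 2 * (norm2 g)\<^sup>2"
    unfolding norm2_squared
    using infsum_mono[OF _ sum bound] fg f g
    by (simp add: sq_summable_def infsum_cmult_right infsum_add summable_on_cmult_right)
  also have "\<dots> \<le> (2 * (norm2 f + norm2 g))\<^sup>2"
    using mult_nonneg_nonneg[OF norm2_nonneg[of f] norm2_nonneg[of g]]
    by (simp add: power2_sum power_mult_distrib algebra_simps)
  finally show "norm2 (\<lambda>t. f t + g t) \<le> 2 * (norm2 f + norm2 g)"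
    by (rule power2_le_imp_le) (simp add: norm2_nonneg)
qed

lemma sq_summable_single: "sq_summable (\<lambda>t. if t = s then w else 0)"
proof -
  have "(\<lambda>t. m t * (norm (if t = s then w else 0))\<^sup>2) summable_on T
      \<longleftrightarrow> (\<lambda>t. m t * (norm (if t = s then w else 0))\<^sup>2) summable_on (T \<inter> {s})"
    by (rule summable_on_cong_neutral) auto
  then show ?thesis
    by (simp add: sq_summable_def)
qed

lemma value_le_norm2:
  assumes "sq_summable f" "t \<in> T"
  shows "norm (f t) \<le> norm2 f / sqrt (m t)"
proof -
  have "(\<Sum>s\<in>{t}. m s * (norm (f s))\<^sup>2) \<le> (norm2 f)\<^sup>2"
    unfolding norm2_squared
    using assms mass_pos by (intro finite_sum_le_infsum) (auto simp: sq_summable_def less_imp_le)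
  then have "(sqrt (m t) * norm (f t))\<^sup>2 \<le> (norm2 f)\<^sup>2"
    using mass_pos[OF assms(2)] by (simp add: power_mult_distrib)
  then have "sqrt (m t) * norm (f t) \<le> norm2 f"
    using norm2_nonneg by (rule power2_le_imp_le)
  then show ?thesis
    using mass_pos[OF assms(2)] by (simp add: field_simps)
qed

lemma product_summable:
  assumes "sq_summable f" "sq_summable g"
  shows "(\<lambda>t. norm (of_real (m t) * (f t * cnj (g t)))) summable_on T"
proof -
  have "(\<lambda>t. m t * (norm (f t))\<^sup>2 + m t * (norm (g t))\<^sup>2) summable_on T"
    using assms unfolding sq_summable_def by (intro summable_on_add)
  then show ?thesis
  proof (rule Infinite_Sum.abs_summable_on_comparison_test')
    fix t assume t: "t \<in> T"
    have "norm (f t) * norm (g t) \<le> (norm (f t))\<^sup>2 + (norm (g t))\<^sup>2"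
      using sum_squares_bound[of "norm (f t)" "norm (g t)"]
        mult_nonneg_nonneg[OF norm_ge_zero[of "f t"] norm_ge_zero[of "g t"]] by linarith
    then have "m t * (norm (f t) * norm (g t)) \<le> m t * ((norm (f t))\<^sup>2 + (norm (g t))\<^sup>2)"
      using mass_pos[OF t] by (intro mult_left_mono) auto
    then show "norm (of_real (m t) * (f t * cnj (g t))) \<le> m t * (norm (f t))\<^sup>2 + m t * (norm (g t))\<^sup>2"
      using mass_pos[OF t] by (simp add: norm_mult distrib_left)
  qed
qed

lemma Cauchy_Schwarz_atomic:
  assumes "sq_summable f" "sq_summable g"
  shows "norm (\<Sum>\<^sub>\<infinity>t\<in>T. of_real (m t) * (f t * cnj (g t))) \<le> norm2 f * norm2 g"
proof -
  let ?h = "\<lambda>t. of_real (m t) * (f t * cnj (g t))"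
  have "norm (infsum ?h T) \<le> infsum (\<lambda>t. norm (?h t)) T"
    using product_summable[OF assms] by (rule norm_infsum_bound)
  also have "\<dots> \<le> norm2 f * norm2 g"
  proof (rule infsum_le_finite_sums[OF product_summable[OF assms]])
    fix F assume F: "finite F" "F \<subseteq> T"
    then have pos: "0 \<le> m t" if "t \<in> F" for t using that mass_pos by (auto intro: less_imp_le)
    have "(\<Sum>t\<in>F. norm (?h t)) = (\<Sum>t\<in>F. (sqrt (m t) * norm (f t)) * (sqrt (m t) * norm (g t)))"
      using pos by (intro sum.cong) (auto simp: norm_mult)
    also have "\<dots> \<le> sqrt ((\<Sum>t\<in>F. (sqrt (m t) * norm (f t))\<^sup>2) * (\<Sum>t\<in>F. (sqrt (m t) * norm (g t))\<^sup>2))"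
      using Cauchy_Schwarz_ineq_sum by (rule real_le_rsqrt)
    also have "\<dots> = sqrt ((\<Sum>t\<in>F. m t * (norm (f t))\<^sup>2) * (\<Sum>t\<in>F. m t * (norm (g t))\<^sup>2))"
      using pos by (simp add: power_mult_distrib)
    also have "\<dots> \<le> sqrt ((norm2 f)\<^sup>2 * (norm2 g)\<^sup>2)"
      unfolding norm2_squared using assms F mass_pos pos
      by (intro real_sqrt_le_mono mult_mono finite_sum_le_infsum sum_nonneg infsum_nonneg)
         (auto simp: sq_summable_def less_imp_le)
    finally show "(\<Sum>t\<in>F. norm (?h t)) \<le> norm2 f * norm2 g"
      by (simp add: real_sqrt_mult abs_of_nonneg[OF norm2_nonneg])
  qed
  finally show ?thesis .
qed

lemma pairing_eq:
  assumes f: "f \<in> borel_measurable borel" and g: "g \<in> borel_measurable borel"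
    and s: "(\<lambda>t. of_real (m t) * (f t * cnj (g t))) summable_on T"
  shows "pairing M f g = (\<Sum>\<^sub>\<infinity>t\<in>T. of_real (m t) * (f t * cnj (g t)))"
proof -
  have "(\<lambda>t. norm (m t *\<^sub>R (f t * cnj (g t)))) summable_on T"
    using s by (simp add: scaleR_conv_of_real summable_on_iff_abs_summable_on_complex)
  moreover have cnj [measurable]: "cnj \<in> borel_measurable borel"
    by (intro borel_measurable_continuous_onI continuous_intros)
  ultimately show ?thesis
    unfolding pairing_def using f g cnj
    by (subst integral_M_eq) (auto simp: scaleR_conv_of_real)
qed

end

section \<open>Zero-free pole series\<close>

text \<open>The terms are \<open>c t * (1 / (t - z) - 1 / t)\<close>.  Written as a single fraction, the term of a point
\<open>t = z\<close> is 0, so that at a point of \<open>T\<close> the value is the regularised sum without the pole there.\<close>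

definition pole_series :: "real set \<Rightarrow> (real \<Rightarrow> complex) \<Rightarrow> complex \<Rightarrow> complex \<Rightarrow> complex" where
  "pole_series T c \<kappa> z = \<kappa> + (\<Sum>\<^sub>\<infinity>t\<in>T. c t * z / (of_real t * (of_real t - z)))"

definition admits_zero_free_series :: "real set \<Rightarrow> bool" where
  "admits_zero_free_series T \<longleftrightarrow> (\<exists>c \<kappa>.
     (\<forall>t\<in>T. c t \<noteq> 0) \<and> (\<lambda>t. norm (c t) / t\<^sup>2) summable_on T \<and>
     (\<forall>z. z \<notin> of_real ` T \<longrightarrow> pole_series T c \<kappa> z \<noteq> 0))"

context discrete_spectrum
begin

text \<open>Each term is \<open>z * (c t / t\<^sup>2)\<close> times the bounded multiplier \<open>t / (t - z)\<close>.\<close>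

lemma pole_series_has_sum:
  assumes "(\<lambda>t. norm (c t) / t\<^sup>2) summable_on T"
  shows "((\<lambda>t. c t * z / (of_real t * (of_real t - z))) has_sum (pole_series T c \<kappa> z - \<kappa>)) T"
proof -
  obtain K where K: "K \<ge> 0" "\<And>t. t \<in> T \<Longrightarrow> norm (of_real t / (of_real t - z)) \<le> K"
    using bounded_multiplier[of z] by auto
  have "(\<lambda>t. norm z * K * (norm (c t) / t\<^sup>2)) summable_on T"
    using assms by (rule summable_on_cmult_right)
  then have "(\<lambda>t. norm (c t * z / (of_real t * (of_real t - z)))) summable_on T"
  proof (rule Infinite_Sum.abs_summable_on_comparison_test')
    fix t assume t: "t \<in> T"
    then have "t \<noteq> 0" using nonzero_T by auto
    then have "c t * z / (of_real t * (of_real t - z))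
        = of_real (1 / t\<^sup>2) * c t * z * (of_real t / (of_real t - z))"
      by (simp add: power2_eq_square divide_simps)
    also have "norm \<dots> = norm z * (norm (c t) / t\<^sup>2) * norm (of_real t / (of_real t - z))"
      by (simp add: norm_mult norm_divide norm_power mult_ac)
    also have "\<dots> \<le> norm z * (norm (c t) / t\<^sup>2) * K"
      using K(2)[OF t] by (intro mult_left_mono) auto
    finally show "norm (c t * z / (of_real t * (of_real t - z))) \<le> norm z * K * (norm (c t) / t\<^sup>2)"
      by (simp add: mult_ac)
  qed
  then have "(\<lambda>t. c t * z / (of_real t * (of_real t - z))) summable_on T"
    by (rule abs_summable_summable)
  then show ?thesis
    by (simp add: pole_series_def)
qed

text \<open>Multiplication by a function with a simple pole at \<open>s\<close> multiplies the coefficient of each old pole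
\<open>t\<close> by the value of the function at \<open>t\<close>, creates a pole at \<open>s\<close> with coefficient
\<open>- \<beta> * G s\<close> (the sign is that of \<open>1 / (s - z)\<close>), and multiplies the value at 0, which is the
constant term, by the value of the function at 0.  For a single term this is the partial fraction
identity \<open>\<beta> / w * (1 / u - 1 / v) = \<beta> / (u * v)\<close> with \<open>u = t - z\<close>, \<open>v = t - s\<close>,
\<open>w = z - s = v - u\<close>.\<close>

lemma pole_series_times_moebius:
  assumes c: "(\<lambda>t. norm (c t) / t\<^sup>2) summable_on T"
    and s: "s \<notin> T" "s \<noteq> 0"
    and c': "\<And>t. t \<in> T \<Longrightarrow> c' t = c t * (\<alpha> + \<beta> / (of_real t - of_real s))"
      "c' s = - \<beta> * pole_series T c \<kappa> (of_real s)"
  shows "(\<lambda>t. norm (c' t) / t\<^sup>2) summable_on insert s T"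
    and "z \<notin> of_real ` insert s T \<Longrightarrow>
      pole_series (insert s T) c' (\<kappa> * (\<alpha> - \<beta> / of_real s)) z
        = (\<alpha> + \<beta> / (z - of_real s)) * pole_series T c \<kappa> z"
proof -
  obtain K where K: "K \<ge> 0" "\<And>t. t \<in> T \<Longrightarrow> norm (1 / (of_real t - of_real s :: complex)) \<le> K"
    using bounded_resolvent_factor[of "of_real s"] by auto
  have "(\<lambda>t. (norm \<alpha> + norm \<beta> * K) * (norm (c t) / t\<^sup>2)) summable_on T"
    using c by (rule summable_on_cmult_right)
  then have "(\<lambda>t. norm (norm (c' t) / t\<^sup>2)) summable_on T"
  proof (rule Infinite_Sum.abs_summable_on_comparison_test')
    fix t assume t: "t \<in> T"
    have "norm (\<alpha> + \<beta> / (of_real t - of_real s)) \<le> norm \<alpha> + norm (\<beta> * (1 / (of_real t - of_real s)))"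
      using norm_triangle_ineq[of \<alpha> "\<beta> / (of_real t - of_real s)"] by simp
    also have "\<dots> \<le> norm \<alpha> + norm \<beta> * K"
      unfolding norm_mult using K(2)[OF t] by (intro add_left_mono mult_left_mono) auto
    finally have "norm (c t) * norm (\<alpha> + \<beta> / (of_real t - of_real s)) \<le> norm (c t) * (norm \<alpha> + norm \<beta> * K)"
      by (rule mult_left_mono) simp
    then show "norm (norm (c' t) / t\<^sup>2) \<le> (norm \<alpha> + norm \<beta> * K) * (norm (c t) / t\<^sup>2)"
      using t by (simp add: c' norm_mult divide_right_mono mult.commute)
  qed
  then have "(\<lambda>t. norm (c' t) / t\<^sup>2) summable_on T"
    by (rule abs_summable_summable)
  then show "(\<lambda>t. norm (c' t) / t\<^sup>2) summable_on insert s T"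
    using summable_on_Un_disjoint[of "\<lambda>t. norm (c' t) / t\<^sup>2" T "{s}"] s by simp
  assume z: "z \<notin> of_real ` insert s T"
  let ?G = "pole_series T c \<kappa>"
  have zs: "z - of_real s \<noteq> 0" using z by auto
  have s0: "of_real s \<noteq> (0 :: complex)" using s by simp
  have "((\<lambda>t. (\<alpha> + \<beta> / (z - of_real s)) * (c t * z / (of_real t * (of_real t - z)))
        + (- \<beta>) * z / (of_real s * (z - of_real s)) * (c t * of_real s / (of_real t * (of_real t - of_real s))))
      has_sum ((\<alpha> + \<beta> / (z - of_real s)) * (?G z - \<kappa>)
        + (- \<beta>) * z / (of_real s * (z - of_real s)) * (?G (of_real s) - \<kappa>))) T"
    by (intro has_sum_add has_sum_cmult_right pole_series_has_sum c)
  also have "?this \<longleftrightarrow> ((\<lambda>t. c' t * z / (of_real t * (of_real t - z)))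
      has_sum ((\<alpha> + \<beta> / (z - of_real s)) * (?G z - \<kappa>)
        + (- \<beta>) * z / (of_real s * (z - of_real s)) * (?G (of_real s) - \<kappa>))) T"
  proof (rule has_sum_cong)
    fix t assume t: "t \<in> T"
    define u v w :: complex where "u = of_real t - z" and "v = of_real t - of_real s" and "w = z - of_real s"
    have nz: "u \<noteq> 0" "v \<noteq> 0" "w \<noteq> 0" "of_real t \<noteq> (0::complex)"
      using t z s nonzero_T by (auto simp: u_def v_def w_def)
    have vuw: "v = u + w" by (simp add: u_def v_def w_def)
    have "1 / u - 1 / v = w / (u * v)"
      using nz diff_frac_eq[of u v 1 1] by (simp add: vuw)
    then have "\<beta> / w * (1 / u) - \<beta> / w * (1 / v) = \<beta> / w * (w / (u * v))"
      by (metis right_diff_distrib)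
    also have "\<dots> = \<beta> / v * (1 / u)"
      using nz by simp
    finally have "\<beta> / w * (1 / u) - \<beta> / w * (1 / v) = \<beta> / v * (1 / u)" .
    then have "(\<alpha> + \<beta> / w) * (1 / u) - \<beta> / w * (1 / v) = (\<alpha> + \<beta> / v) * (1 / u)"
      by (simp add: algebra_simps)
    then have "c t * z / of_real t * ((\<alpha> + \<beta> / w) * (1 / u) - \<beta> / w * (1 / v))
        = c t * z / of_real t * ((\<alpha> + \<beta> / v) * (1 / u))" by simp
    then show "(\<alpha> + \<beta> / (z - of_real s)) * (c t * z / (of_real t * (of_real t - z)))
        + (- \<beta>) * z / (of_real s * (z - of_real s)) * (c t * of_real s / (of_real t * (of_real t - of_real s)))
        = c' t * z / (of_real t * (of_real t - z))"
      unfolding c'(1)[OF t] u_def[symmetric] v_def[symmetric] w_def[symmetric]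
      using s0 by (simp add: algebra_simps add_divide_distrib diff_divide_distrib)
  qed
  finally have "((\<lambda>t. c' t * z / (of_real t * (of_real t - z)))
      has_sum ((\<alpha> + \<beta> / (z - of_real s)) * (?G z - \<kappa>)
        + (- \<beta>) * z / (of_real s * (z - of_real s)) * (?G (of_real s) - \<kappa>)
        + c' s * z / (of_real s * (of_real s - z)))) (T \<union> {s})"
    using s(1) by (intro has_sum_Un_disjoint) (auto intro: has_sum_finiteI)
  then have "pole_series (insert s T) c' (\<kappa> * (\<alpha> - \<beta> / of_real s)) z
      = \<kappa> * (\<alpha> - \<beta> / of_real s) + ((\<alpha> + \<beta> / (z - of_real s)) * (?G z - \<kappa>)
        + (- \<beta>) * z / (of_real s * (z - of_real s)) * (?G (of_real s) - \<kappa>)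
        + c' s * z / (of_real s * (of_real s - z)))"
    unfolding pole_series_def[of "insert s T"] by (simp add: infsumI)
  also have "\<dots> = (\<alpha> + \<beta> / (z - of_real s)) * ?G z"
  proof -
    define w where "w = z - of_real s"
    have w: "w \<noteq> 0" "of_real s - z = - w" "z = w + of_real s" using zs by (auto simp: w_def)
    have "\<beta> / of_real s + \<beta> / w = \<beta> * z / (of_real s * w)"
      using w(1) s0 by (simp add: w(3) field_simps)
    then have "\<kappa> * (\<beta> * z / (of_real s * w)) = \<kappa> * (\<beta> / of_real s) + \<kappa> * (\<beta> / w)"
      by (metis distrib_left)
    then show ?thesis
      unfolding c'(2) w_def[symmetric] w(2) by (simp add: algebra_simps add_divide_distrib diff_divide_distrib)
  qed
  finally show "pole_series (insert s T) c' (\<kappa> * (\<alpha> - \<beta> / of_real s)) z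
      = (\<alpha> + \<beta> / (z - of_real s)) * ?G z" .
qed

text \<open>This is the factor \<open>1 / (z - s)\<close>.  The new coefficient at \<open>s\<close> is nonzero because \<open>G s \<noteq> 0\<close>.\<close>

lemma admits_zero_free_series_insert:
  assumes "admits_zero_free_series T" and s: "s \<notin> T" "s \<noteq> 0"
  shows "admits_zero_free_series (insert s T)"
proof -
  obtain c \<kappa> where c: "\<forall>t\<in>T. c t \<noteq> 0" "(\<lambda>t. norm (c t) / t\<^sup>2) summable_on T"
    and G: "\<And>z. z \<notin> of_real ` T \<Longrightarrow> pole_series T c \<kappa> z \<noteq> 0"
    using assms(1) unfolding admits_zero_free_series_def by blast
  define c' where "c' t = (if t = s then - pole_series T c \<kappa> (of_real s)
    else c t * (0 + 1 / (of_real t - of_real s)))" for t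
  have c'T: "c' t = c t * (0 + 1 / (of_real t - of_real s))" if "t \<in> T" for t
    using that s by (auto simp: c'_def)
  have c's: "c' s = - 1 * pole_series T c \<kappa> (of_real s)"
    by (simp add: c'_def)
  have "pole_series T c \<kappa> (of_real s) \<noteq> 0"
    using s by (intro G) auto
  then have "\<forall>t\<in>insert s T. c' t \<noteq> 0"
    using c(1) s by (auto simp: c'_def)
  moreover have "pole_series (insert s T) c' (\<kappa> * (0 - 1 / of_real s)) z \<noteq> 0"
    if z: "z \<notin> of_real ` insert s T" for z
    using pole_series_times_moebius(2)[OF c(2) s c'T c's z] G[of z] z by auto
  ultimately show ?thesis
    unfolding admits_zero_free_series_def
    using pole_series_times_moebius(1)[OF c(2) s c'T c's] by blast
qed

text \<open>The factor \<open>1 + (s - d) / (z - s) = (z - d) / (z - s)\<close> vanishes at \<open>d\<close> and so cancels the pole of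
\<open>G\<close> there.  It has no other zero, but since \<open>d\<close> is no longer a pole, the new series must be
evaluated at \<open>d\<close> too: its value is the limit of \<open>G z * (z - d) / (z - s)\<close>, which is
\<open>- c d / (d - s)\<close> and hence nonzero.\<close>

lemma admits_zero_free_series_exchange:
  assumes "admits_zero_free_series T" and s: "s \<notin> T" "s \<noteq> 0" and d: "d \<in> T"
  shows "admits_zero_free_series (insert s (T - {d}))"
proof -
  obtain c \<kappa> where c: "\<forall>t\<in>T. c t \<noteq> 0" "(\<lambda>t. norm (c t) / t\<^sup>2) summable_on T"
    and G: "\<And>z. z \<notin> of_real ` T \<Longrightarrow> pole_series T c \<kappa> z \<noteq> 0"
    using assms(1) unfolding admits_zero_free_series_def by blast
  let ?\<beta> = "of_real s - of_real d :: complex"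
  let ?G = "pole_series T c \<kappa>"
  let ?\<kappa> = "\<kappa> * (1 - ?\<beta> / of_real s)"
  define c' where "c' t = (if t = s then - ?\<beta> * ?G (of_real s)
    else c t * (1 + ?\<beta> / (of_real t - of_real s)))" for t
  have c'T: "c' t = c t * (1 + ?\<beta> / (of_real t - of_real s))" if "t \<in> T" for t
    using that s by (auto simp: c'_def)
  have c's: "c' s = - ?\<beta> * ?G (of_real s)"
    by (simp add: c'_def)
  have ds: "d \<noteq> s" "d \<noteq> 0" using s d nonzero_T by auto
  have c'_eq: "c' t = c t * (of_real t - of_real d) / (of_real t - of_real s)" if "t \<in> T" for t
  proof -
    have "of_real t - of_real s \<noteq> (0::complex)" using that s by auto
    then show ?thesis by (simp add: c'T[OF that] field_simps)
  qed
  have "?G (of_real s) \<noteq> 0"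
    using s by (intro G) auto
  then have "\<forall>t\<in>insert s (T - {d}). c' t \<noteq> 0"
    using c(1) s ds c'_eq by (auto simp: c's)
  moreover have "(\<lambda>t. norm (c' t) / t\<^sup>2) summable_on insert s (T - {d})"
    using pole_series_times_moebius(1)[OF c(2) s c'T c's]
    by (rule summable_on_subset_banach) auto
  moreover have "pole_series (insert s (T - {d})) c' ?\<kappa> z \<noteq> 0"
    if z: "z \<notin> of_real ` insert s (T - {d})" for z
  proof (cases "z = of_real d")
    case False
    then have z': "z \<notin> of_real ` insert s T" using z by auto
    have "pole_series (insert s (T - {d})) c' ?\<kappa> z = pole_series (insert s T) c' ?\<kappa> z"
      unfolding pole_series_def using ds d c'_eq[OF d]
      by (intro arg_cong2[where f = "(+)"] infsum_cong_neutral) auto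
    also have "\<dots> = (1 + ?\<beta> / (z - of_real s)) * ?G z"
      by (rule pole_series_times_moebius(2)[OF c(2) s c'T c's z'])
    also have "1 + ?\<beta> / (z - of_real s) = (z - of_real d) / (z - of_real s)"
      using z' by (simp add: field_simps)
    finally show ?thesis
      using False G[of z] z' by auto
  next
    case True
    \<comment> \<open>At \<open>z = d\<close> the factor \<open>t - d\<close> of \<open>c' t\<close> cancels, which leaves \<open>d / s\<close> times the terms
      of the series of \<open>G s\<close>.\<close>
    have "((\<lambda>t. c t * of_real s / (of_real t * (of_real t - of_real s))) has_sum
        (?G (of_real s) - \<kappa> - c d * of_real s / (of_real d * (of_real d - of_real s)))) (T - {d})"
      using d by (intro has_sum_Diff pole_series_has_sum c) (auto intro: has_sum_finiteI)
    then have "((\<lambda>t. of_real d / of_real s * (c t * of_real s / (of_real t * (of_real t - of_real s)))) has_sum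
        of_real d / of_real s * (?G (of_real s) - \<kappa> - c d * of_real s / (of_real d * (of_real d - of_real s)))) (T - {d})"
      by (rule has_sum_cmult_right)
    also have "?this \<longleftrightarrow> ((\<lambda>t. c' t * z / (of_real t * (of_real t - z))) has_sum
        of_real d / of_real s * (?G (of_real s) - \<kappa> - c d * of_real s / (of_real d * (of_real d - of_real s)))) (T - {d})"
      using s nonzero_T by (intro has_sum_cong) (auto simp: c'_eq True mult_ac)
    finally have "((\<lambda>t. c' t * z / (of_real t * (of_real t - z))) has_sum
        (of_real d / of_real s * (?G (of_real s) - \<kappa> - c d * of_real s / (of_real d * (of_real d - of_real s)))
          + c' s * z / (of_real s * (of_real s - z)))) ((T - {d}) \<union> {s})"
      using s(1) by (intro has_sum_Un_disjoint) (auto intro: has_sum_finiteI)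
    then have "pole_series (insert s (T - {d})) c' ?\<kappa> z
      = ?\<kappa> + (of_real d / of_real s * (?G (of_real s) - \<kappa> - c d * of_real s / (of_real d * (of_real d - of_real s)))
          + c' s * z / (of_real s * (of_real s - z)))"
      unfolding pole_series_def[of "insert s (T - {d})"] by (simp add: infsumI)
    also have "\<dots> = - c d / (of_real d - of_real s)"
    proof -
      have cancel: "- e * g * x / (y * e) = - (x / y) * g" if "e \<noteq> 0" "y \<noteq> 0" for e g x y :: complex
        using that by (simp add: field_simps)
      have "?\<kappa> = \<kappa> * (of_real d / of_real s)"
        using s(2) by (simp add: field_simps)
      moreover have "c' s * z / (of_real s * (of_real s - z)) = - (of_real d / of_real s) * ?G (of_real s)"
        using cancel[of ?\<beta> "of_real s"] ds s(2) by (simp only: c's True) simp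
      moreover have "of_real d / of_real s * (c d * of_real s / (of_real d * (of_real d - of_real s)))
          = c d / (of_real d - of_real s)"
        using ds s(2) by simp
      ultimately show ?thesis
        by (simp add: algebra_simps)
    qed
    finally show ?thesis
      using ds d c(1) by auto
  qed
  ultimately show ?thesis
    unfolding admits_zero_free_series_def by blast
qed

end

section \<open>The spectrum of a singular rank one perturbation\<close>

context atomic_spectrum
begin

lemma sq_summable_at_single_point:
  "sq_summable (\<lambda>t. if of_real t = (z :: complex) then w else 0)"
proof (rule sq_summable_bound[where K = 1])
  show "sq_summable (\<lambda>t. if t = Re z then w else 0)" by (rule sq_summable_single)
qed auto

lemma sq_summable_mult_resolvent:
  assumes "sq_summable g"
  shows "sq_summable (\<lambda>t. g t / (of_real t - z))"
proof -
  obtain K where "K \<ge> 0" and K: "\<And>t. t \<in> T \<Longrightarrow> norm (1 / (of_real t - z)) \<le> K"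
    using bounded_resolvent_factor by blast
  show ?thesis
  proof (rule sq_summable_bound[OF assms \<open>K \<ge> 0\<close>])
    fix t assume "t \<in> T"
    then have "norm (1 / (of_real t - z)) * norm (g t) \<le> K * norm (g t)"
      by (intro mult_right_mono K) auto
    then show "norm (g t / (of_real t - z)) \<le> K * norm (g t)"
      by (simp add: norm_divide)
  qed
qed

lemma sq_summable_mult_bounded:
  assumes "sq_summable g"
  shows "sq_summable (\<lambda>t. g t * (of_real t / (of_real t - z)))"
proof -
  obtain K where "K \<ge> 0" and K: "\<And>t. t \<in> T \<Longrightarrow> norm (of_real t / (of_real t - z)) \<le> K"
    using bounded_multiplier by blast
  show ?thesis
  proof (rule sq_summable_bound[OF assms \<open>K \<ge> 0\<close>])
    fix t assume "t \<in> T"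
    then have "norm (of_real t / (of_real t - z)) * norm (g t) \<le> K * norm (g t)"
      by (intro mult_right_mono K) auto
    then show "norm (g t * (of_real t / (of_real t - z))) \<le> K * norm (g t)"
      by (simp only: norm_mult mult.commute)
  qed
qed

lemma sq_summable_cmult: "sq_summable g \<Longrightarrow> sq_summable (\<lambda>t. w * g t)"
  by (rule sq_summable_bound[where K = "norm w"]) (auto simp: norm_mult)

lemma measurable_of_quotient:
  fixes f :: "real \<Rightarrow> complex"
  assumes "(\<lambda>x. f x / of_real x) \<in> borel_measurable borel"
  shows "f \<in> borel_measurable borel"
proof (rule measurable_discrete_difference[where X = "{0}"])
  show "(\<lambda>x. of_real x * (f x / of_real x)) \<in> borel_measurable borel"
    using assms by measurable
qed auto

end

locale rank_one_data = atomic_spectrum +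
  fixes a b :: "real \<Rightarrow> complex" and \<kappa> :: complex
  assumes a_L2: "(\<lambda>x. a x / of_real x) \<in> L2_space M"
    and b_L2: "(\<lambda>x. b x / of_real x) \<in> L2_space M"
begin

abbreviation "L \<equiv> singular_perturbation M a b \<kappa>"

lemma sq_summable_a: "sq_summable (\<lambda>t. a t / of_real t)"
  and sq_summable_b: "sq_summable (\<lambda>t. b t / of_real t)"
  using a_L2 b_L2 by (simp_all add: L2_iff)

text \<open>A function \<open>y\<close> in the domain of multiplication by \<open>x\<close> pairs with \<open>b\<close>, although \<open>b\<close> need not be
square integrable: the factor \<open>x\<close> moves from \<open>b\<close> to \<open>y\<close>.\<close>

lemma product_with_b_summable:
  assumes "sq_summable (\<lambda>t. of_real t * y t)"
  shows "(\<lambda>t. of_real (m t) * (y t * cnj (b t))) summable_on T"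
proof -
  have "(\<lambda>t. of_real (m t) * ((of_real t * y t) * cnj (b t / of_real t))) summable_on T"
    using product_summable[OF assms sq_summable_b] by (rule abs_summable_summable)
  also have "?this \<longleftrightarrow> ?thesis"
    using nonzero_T by (intro summable_on_cong) auto
  finally show ?thesis .
qed

lemma pairing_with_b:
  assumes "y \<in> borel_measurable borel" "sq_summable (\<lambda>t. of_real t * y t)"
  shows "pairing M y b = (\<Sum>\<^sub>\<infinity>t\<in>T. of_real (m t) * (y t * cnj (b t)))"
  using assms b_L2 product_with_b_summable
  by (intro pairing_eq) (auto simp: L2_iff intro: measurable_of_quotient)

lemma perturbation_graphE:
  assumes "(y, h) \<in> L"
  obtains c y0 where "y \<in> L2_space M" "h \<in> L2_space M"
    and "\<And>t. t \<in> T \<Longrightarrow> y t = y0 t + c * (a t / of_real t)"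
    and "\<And>t. t \<in> T \<Longrightarrow> h t = of_real t * y0 t"
    and "\<kappa> * c + (\<Sum>\<^sub>\<infinity>t\<in>T. of_real (m t) * (y0 t * cnj (b t))) = 0"
  using assms pairing_with_b
  unfolding singular_perturbation_def mult_domain_def AE_M_iff L2_iff by fastforce

text \<open>Functions on \<open>T\<close> suffice to describe elements of the graph, because the graph is closed under
changes off \<open>T\<close>; extension by zero makes them measurable.\<close>

lemma perturbation_graphI:
  assumes y0: "sq_summable (\<lambda>t. of_real t * y0 t)"
    and bc: "\<kappa> * c + (\<Sum>\<^sub>\<infinity>t\<in>T. of_real (m t) * (y0 t * cnj (b t))) = 0"
  obtains y h where "(y, h) \<in> L"
    and "\<And>t. t \<in> T \<Longrightarrow> y t = y0 t + c * (a t / of_real t)"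
    and "\<And>t. t \<in> T \<Longrightarrow> h t = of_real t * y0 t"
proof
  let ?cut = "\<lambda>f x. if x \<in> T then f x else (0 :: complex)"
  let ?u = "?cut y0"
  let ?h = "?cut (\<lambda>t. of_real t * y0 t)"
  let ?y = "?cut (\<lambda>t. y0 t + c * (a t / of_real t))"
  have cut_L2: "?cut f \<in> L2_space M" if "sq_summable f" for f
    using that measurable_off_T[of "?cut f"]
    by (auto simp: L2_iff sq_summable_def cong: summable_on_cong)
  have "sq_summable y0"
  proof -
    have "sq_summable (\<lambda>t. of_real t * y0 t / (of_real t - 0))"
      using y0 by (rule sq_summable_mult_resolvent)
    also have "?this \<longleftrightarrow> sq_summable y0"
      unfolding sq_summable_def using nonzero_T by (intro summable_on_cong) auto
    finally show ?thesis .
  qed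
  have "?y \<in> L2_space M"
    by (intro cut_L2 sq_summable_add sq_summable_cmult sq_summable_a \<open>sq_summable y0\<close>)
  moreover have h: "?h \<in> L2_space M"
    by (intro cut_L2 y0)
  moreover have "?u \<in> mult_domain M"
  proof -
    have "(\<lambda>x. of_real x * ?u x) = ?h" by auto
    then show ?thesis
      using h cut_L2[OF \<open>sq_summable y0\<close>] by (simp add: mult_domain_def)
  qed
  moreover have "pairing M ?u b = (\<Sum>\<^sub>\<infinity>t\<in>T. of_real (m t) * (y0 t * cnj (b t)))"
    using \<open>?u \<in> mult_domain M\<close>
    by (subst pairing_with_b) (auto simp: mult_domain_def L2_iff intro!: infsum_cong)
  ultimately show "(?y, ?h) \<in> L"
    using bc unfolding singular_perturbation_def AE_M_iff
    by (auto intro!: exI[of _ c] bexI[of _ ?u])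
qed auto

definition coupling :: "real \<Rightarrow> complex" where
  "coupling t = of_real (m t) * (a t * cnj (b t))"

lemma coupling_summable: "(\<lambda>t. norm (coupling t) / t\<^sup>2) summable_on T"
proof -
  have "(\<lambda>t. norm (of_real (m t) * ((a t / of_real t) * cnj (b t / of_real t)))) summable_on T"
    by (rule product_summable[OF sq_summable_a sq_summable_b])
  also have "?this \<longleftrightarrow> ?thesis"
    by (intro summable_on_cong) (auto simp: coupling_def norm_mult norm_divide power2_eq_square)
  finally show ?thesis .
qed

abbreviation "G \<equiv> pole_series T coupling \<kappa>"

text \<open>If \<open>a s = 0\<close> for some \<open>s \<in> T\<close>, then every function in the range of \<open>L - s\<close> vanishes at \<open>s\<close>.  If
\<open>b s = 0\<close>, then the indicator function of \<open>s\<close> is an eigenvector with eigenvalue \<open>s\<close>.  If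
\<open>G z = 0\<close> off \<open>T\<close>, then \<open>a / (x - z)\<close> is an eigenvector with eigenvalue \<open>z\<close>; it is not zero since
\<open>a\<close> is not.\<close>

lemma empty_spectrum_imp:
  assumes "spectrum M L = {}"
  shows "\<forall>t\<in>T. a t \<noteq> 0 \<and> b t \<noteq> 0" and "\<And>z. z \<notin> of_real ` T \<Longrightarrow> G z \<noteq> 0"
proof -
  have kernel_trivial: "\<forall>t\<in>T. y t = 0" if "(y, h) \<in> L" "\<And>t. t \<in> T \<Longrightarrow> h t - z * y t = 0" for y h z
  proof -
    obtain y' h' where 0: "(y', h') \<in> L" "\<And>t. t \<in> T \<Longrightarrow> y' t = 0" "\<And>t. t \<in> T \<Longrightarrow> h' t = 0"
      by (rule perturbation_graphI[of "\<lambda>_. 0" 0]) (auto simp: sq_summable_def)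
    have "z \<in> resolvent_set M L" using assms by (auto simp: spectrum_def)
    then have "\<forall>(y, h)\<in>L. \<forall>(y', h')\<in>L.
        (\<forall>t\<in>T. h t - z * y t = h' t - z * y' t) \<longrightarrow> (\<forall>t\<in>T. y t = y' t)"
      by (simp add: resolvent_set_def AE_M_iff)
    then show ?thesis using that 0 by fastforce
  qed
  show ab: "\<forall>t\<in>T. a t \<noteq> 0 \<and> b t \<noteq> 0"
  proof (intro ballI conjI notI)
    fix s assume s: "s \<in> T" and "a s = 0"
    have "(\<lambda>t. if t = s then 1 else 0) \<in> L2_space M"
      using s by (auto simp: L2_iff sq_summable_single intro!: measurable_off_T)
    moreover have "of_real s \<in> resolvent_set M L"
      using assms by (auto simp: spectrum_def)
    ultimately obtain y h where yh: "(y, h) \<in> L"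
      and g: "\<And>t. t \<in> T \<Longrightarrow> h t - of_real s * y t = (if t = s then 1 else 0)"
      unfolding resolvent_set_def AE_M_iff by fast
    from yh obtain c y0 where "y s = y0 s + c * (a s / of_real s)" "h s = of_real s * y0 s"
      using s by (auto elim!: perturbation_graphE)
    then show False using g[OF s] \<open>a s = 0\<close> by simp
  next
    fix s assume s: "s \<in> T" and b: "b s = 0"
    let ?e = "\<lambda>t. if t = s then 1 else 0 :: complex"
    have "(\<lambda>t. of_real t * ?e t) = (\<lambda>t. if t = s then of_real s else 0)" by auto
    then have "sq_summable (\<lambda>t. of_real t * ?e t)"
      using sq_summable_single[of s "of_real s"] by simp
    moreover have "\<kappa> * 0 + (\<Sum>\<^sub>\<infinity>t\<in>T. of_real (m t) * (?e t * cnj (b t))) = 0"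
      using b by (auto intro!: infsum_0)
    ultimately obtain y h where yh: "(y, h) \<in> L" "\<And>t. t \<in> T \<Longrightarrow> y t = ?e t + 0 * (a t / of_real t)"
        "\<And>t. t \<in> T \<Longrightarrow> h t = of_real t * ?e t"
      by (rule perturbation_graphI) blast
    from yh(1) have "\<forall>t\<in>T. y t = 0"
      by (rule kernel_trivial[where z = "of_real s"]) (simp add: yh)
    then have "y s = 0" using s by (rule bspec)
    then show False by (simp add: yh s)
  qed
  show "G z \<noteq> 0" if z: "z \<notin> of_real ` T" for z
  proof
    assume G0: "G z = 0"
    \<comment> \<open>The decomposition \<open>a / (x - z) = y0 + 1 * (a / x)\<close>; the boundary condition reads
      \<open>G z = 0\<close>.\<close>
    define y0 where "y0 t = z * a t / (of_real t * (of_real t - z))" for t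
    have "sq_summable (\<lambda>t. z * (a t / of_real t * (of_real t / (of_real t - z))))"
      by (intro sq_summable_cmult sq_summable_mult_bounded sq_summable_a)
    also have "?this \<longleftrightarrow> sq_summable (\<lambda>t. of_real t * y0 t)"
      unfolding sq_summable_def using nonzero_T by (intro summable_on_cong) (auto simp: y0_def)
    finally have "sq_summable (\<lambda>t. of_real t * y0 t)" .
    moreover have "\<kappa> * 1 + (\<Sum>\<^sub>\<infinity>t\<in>T. of_real (m t) * (y0 t * cnj (b t))) = G z"
      by (auto simp: pole_series_def y0_def coupling_def mult_ac intro!: infsum_cong)
    then have "\<kappa> * 1 + (\<Sum>\<^sub>\<infinity>t\<in>T. of_real (m t) * (y0 t * cnj (b t))) = 0"
      using G0 by simp
    ultimately obtain y h where yh: "(y, h) \<in> L" "\<And>t. t \<in> T \<Longrightarrow> y t = y0 t + 1 * (a t / of_real t)"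
        "\<And>t. t \<in> T \<Longrightarrow> h t = of_real t * y0 t"
      by (rule perturbation_graphI) blast
    have y: "y t = a t / (of_real t - z)" and h: "h t = z * a t / (of_real t - z)" if t: "t \<in> T" for t
    proof -
      have "of_real t \<noteq> (0::complex)" "of_real t - z \<noteq> 0" using t nonzero_T z by auto
      then show "y t = a t / (of_real t - z)" "h t = z * a t / (of_real t - z)"
        using t by (simp_all add: yh y0_def field_simps)
    qed
    have "\<forall>t\<in>T. y t = 0"
      using yh(1) by (rule kernel_trivial[where z = z]) (simp add: y h)
    moreover obtain t where "t \<in> T" using ex_large[of 0] by blast
    ultimately show False using ab y z by auto
  qed
qed

end

lemma (in atomic_spectrum) removable_imp_admits_zero_free_series:
  assumes "removable T m"
  shows "admits_zero_free_series T"
proof -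
  obtain a b \<kappa> where data: "perturbation_data M a b \<kappa>"
    and spec: "spectrum M (singular_perturbation M a b \<kappa>) = {}"
    using assms unfolding removable_def by blast
  interpret rank_one_data T m a b \<kappa>
    using data by unfold_locales (auto simp: perturbation_data_def)
  have "\<forall>t\<in>T. coupling t \<noteq> 0"
  proof
    fix t assume "t \<in> T"
    then show "coupling t \<noteq> 0"
      using empty_spectrum_imp(1)[OF spec] mass_pos[of t] by (simp add: coupling_def)
  qed
  then show ?thesis
    unfolding admits_zero_free_series_def
    using empty_spectrum_imp(2)[OF spec] coupling_summable by blast
qed

section \<open>The resolvent of a perturbation with zero-free pole series\<close>

context rank_one_data
begin

text \<open>In a coordinate \<open>t \<noteq> z\<close> the equation \<open>(L - z) y = g\<close> determines the part \<open>y0\<close> of \<open>y\<close> in the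
domain of multiplication.  For \<open>t = z\<close> the two contributions of \<open>y0\<close> cancel, so this coordinate of
\<open>y0\<close> stays free and the equation becomes a condition on the scalar \<open>c\<close>.\<close>

lemma resolvent_coordinate:
  assumes t: "t \<in> T" and y: "y = y0 + c * (a t / of_real t)" and h: "h = of_real t * y0"
  shows "h - z * y = g \<longleftrightarrow>
    (if of_real t = z then g + c * a t = 0
     else y0 = g / (of_real t - z) + c * (z * a t / (of_real t * (of_real t - z))))"
proof (cases "of_real t = z")
  case True
  have "of_real t \<noteq> (0 :: complex)" using t nonzero_T by auto
  then have "h - z * y = - (c * a t)"
    unfolding y h True[symmetric] by (simp add: algebra_simps)
  moreover have "- (c * a t) = g \<longleftrightarrow> g + c * a t = 0"
    by (metis add.commute neg_eq_iff_add_eq_0)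
  ultimately show ?thesis using True by simp
next
  case False
  define u where "u = of_real t - z"
  have nz: "of_real t \<noteq> (0 :: complex)" "u \<noteq> 0" using t nonzero_T False by (auto simp: u_def)
  have "h - z * y = u * y0 - z * c * a t / of_real t"
    unfolding y h u_def by (simp add: algebra_simps)
  also have "\<dots> = g \<longleftrightarrow> y0 = g / u + c * (z * a t / (of_real t * u))"
    using nz by (auto simp: field_simps)
  finally show ?thesis using False by (simp add: u_def)
qed

text \<open>The part \<open>y0\<close> of the solution.  In a coordinate \<open>t = z\<close> both quotients are divisions by zero, thus
0, and the value is the free parameter \<open>d\<close>.\<close>

definition free_part :: "complex \<Rightarrow> (real \<Rightarrow> complex) \<Rightarrow> complex \<Rightarrow> complex \<Rightarrow> real \<Rightarrow> complex" where
  "free_part z g c d t = g t / (of_real t - z) + c * (z * a t / (of_real t * (of_real t - z)))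
     + (if of_real t = z then d else 0)"

text \<open>The pairing of \<open>g / (x - z)\<close> with \<open>b\<close>, written with the denominator on the side of \<open>b\<close>, so that it
is visibly the pairing of \<open>g\<close> with a fixed square summable function.\<close>

definition resolvent_functional :: "complex \<Rightarrow> (real \<Rightarrow> complex) \<Rightarrow> complex" where
  "resolvent_functional z g = (\<Sum>\<^sub>\<infinity>t\<in>T. of_real (m t) * (g t * cnj (b t / (of_real t - cnj z))))"

definition point_weight :: "complex \<Rightarrow> complex" where
  "point_weight z = (if z \<in> of_real ` T then of_real (m (Re z)) * cnj (b (Re z)) else 0)"

lemma sq_summable_b_resolvent: "sq_summable (\<lambda>t. b t / (of_real t - z))"
proof -
  have "sq_summable (\<lambda>t. b t / of_real t * (of_real t / (of_real t - z)))"
    by (intro sq_summable_mult_bounded sq_summable_b)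
  also have "?this \<longleftrightarrow> ?thesis"
    unfolding sq_summable_def using nonzero_T by (intro summable_on_cong) auto
  finally show ?thesis .
qed

lemma free_part_pairing:
  assumes g: "sq_summable g"
  shows "(\<Sum>\<^sub>\<infinity>t\<in>T. of_real (m t) * (free_part z g c d t * cnj (b t)))
    = resolvent_functional z g + c * (G z - \<kappa>) + d * point_weight z"
proof -
  have 1: "((\<lambda>t. of_real (m t) * (g t * cnj (b t / (of_real t - cnj z)))) has_sum resolvent_functional z g) T"
    unfolding resolvent_functional_def
    by (rule has_sum_infsum[OF abs_summable_summable[OF product_summable[OF g sq_summable_b_resolvent]]])
  have 2: "((\<lambda>t. c * (coupling t * z / (of_real t * (of_real t - z)))) has_sum c * (G z - \<kappa>)) T"
    by (intro has_sum_cmult_right pole_series_has_sum coupling_summable)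
  have 3: "((\<lambda>t. of_real (m t) * ((if of_real t = z then d else 0) * cnj (b t))) has_sum d * point_weight z) T"
  proof (cases "z \<in> of_real ` T")
    case True
    then obtain s where s: "s \<in> T" "z = of_real s" by auto
    have "((\<lambda>t. of_real (m t) * ((if of_real t = z then d else 0) * cnj (b t))) has_sum d * point_weight z) {s}"
      using s by (intro has_sum_finiteI) (auto simp: point_weight_def)
    also have "?this \<longleftrightarrow> ?thesis"
      using s by (intro has_sum_cong_neutral) auto
    finally show ?thesis .
  next
    case False
    then have "((\<lambda>t. of_real (m t) * ((if of_real t = z then d else 0) * cnj (b t))) has_sum 0) T"
      by (intro has_sum_0) auto
    then show ?thesis using False by (simp add: point_weight_def)
  qed
  have "((\<lambda>t. of_real (m t) * (free_part z g c d t * cnj (b t)))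
      has_sum resolvent_functional z g + c * (G z - \<kappa>) + d * point_weight z) T"
    using has_sum_add[OF has_sum_add[OF 1 2] 3]
    by (rule has_sum_cong[THEN iffD1, rotated])
       (simp add: free_part_def coupling_def algebra_simps)
  then show ?thesis by (rule infsumI)
qed

lemma sq_summable_mult_free_part:
  assumes g: "sq_summable g"
  shows "sq_summable (\<lambda>t. of_real t * free_part z g c d t)"
proof -
  have "sq_summable (\<lambda>t. g t * (of_real t / (of_real t - z))
      + c * z * (a t / of_real t * (of_real t / (of_real t - z)))
      + (if of_real t = z then z * d else 0))"
    by (intro sq_summable_add sq_summable_cmult sq_summable_mult_bounded g sq_summable_a
      sq_summable_at_single_point)
  also have "?this \<longleftrightarrow> ?thesis"
    unfolding sq_summable_def using nonzero_T
    by (intro summable_on_cong arg_cong2[where f = "(*)"] arg_cong[where f = "\<lambda>w. (cmod w)\<^sup>2"])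
       (auto simp: free_part_def distrib_left mult_ac)
  finally show ?thesis .
qed

text \<open>The conditions that remain for the two scalars in \<open>y = free_part z g c d + c * (a / x)\<close>: the
boundary condition in the domain of \<open>L\<close>, and the equation in the coordinate \<open>z\<close> if \<open>z\<close> belongs to
\<open>T\<close>.  Otherwise \<open>d\<close> does not occur in the solution and is normalised to 0.\<close>

definition solves :: "complex \<Rightarrow> (real \<Rightarrow> complex) \<Rightarrow> complex \<Rightarrow> complex \<Rightarrow> bool" where
  "solves z g c d \<longleftrightarrow> resolvent_functional z g + c * G z + d * point_weight z = 0 \<and>
     (if z \<in> of_real ` T then g (Re z) + c * a (Re z) = 0 else d = 0)"

lemma L2_residual:
  assumes "y \<in> L2_space M" "h \<in> L2_space M"
  shows "(\<lambda>t. h t - z * y t) \<in> L2_space M"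
proof -
  have "sq_summable (\<lambda>t. h t + (- z) * y t)"
    using assms by (intro sq_summable_add sq_summable_cmult) (auto simp: L2_iff)
  moreover have "(\<lambda>t. h t - z * y t) \<in> borel_measurable borel"
    using assms by (intro borel_measurable_diff borel_measurable_times) (auto simp: L2_iff)
  ultimately show ?thesis by (simp add: L2_iff)
qed

lemma resolvent_solution_form:
  assumes yh: "(y, h) \<in> L"
  obtains c d where "solves z (\<lambda>t. h t - z * y t) c d"
    and "\<And>t. t \<in> T \<Longrightarrow> y t = free_part z (\<lambda>t. h t - z * y t) c d t + c * (a t / of_real t)"
proof -
  let ?g = "\<lambda>t. h t - z * y t"
  from yh obtain c y0 where L2: "y \<in> L2_space M" "h \<in> L2_space M"
    and y: "\<And>t. t \<in> T \<Longrightarrow> y t = y0 t + c * (a t / of_real t)"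
    and h: "\<And>t. t \<in> T \<Longrightarrow> h t = of_real t * y0 t"
    and bc: "\<kappa> * c + (\<Sum>\<^sub>\<infinity>t\<in>T. of_real (m t) * (y0 t * cnj (b t))) = 0"
    by (rule perturbation_graphE) blast
  have g: "sq_summable ?g"
    using L2_residual[OF L2] by (simp add: L2_iff)
  define d where "d = (if z \<in> of_real ` T then y0 (Re z) else 0)"
  have y0: "y0 t = free_part z ?g c d t" if t: "t \<in> T" for t
    using resolvent_coordinate[OF t y[OF t] h[OF t], of z "?g t"] t
    by (auto simp: free_part_def d_def split: if_splits)
  have "solves z ?g c d"
    unfolding solves_def
  proof
    have "0 = \<kappa> * c + (\<Sum>\<^sub>\<infinity>t\<in>T. of_real (m t) * (free_part z ?g c d t * cnj (b t)))"
      unfolding bc[symmetric] by (intro arg_cong2[where f = "(+)"] infsum_cong) (simp_all add: y0)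
    then show "resolvent_functional z ?g + c * G z + d * point_weight z = 0"
      unfolding free_part_pairing[OF g] by (simp add: algebra_simps)
    show "if z \<in> of_real ` T then ?g (Re z) + c * a (Re z) = 0 else d = 0"
    proof (cases "z \<in> of_real ` T")
      case True
      then obtain t where t: "t \<in> T" "z = of_real t" by auto
      then show ?thesis
        using resolvent_coordinate[OF t(1) y[OF t(1)] h[OF t(1)], of z "?g t"] by auto
    qed (simp add: d_def)
  qed
  then show thesis
    by (rule that) (simp add: y flip: y0)
qed

lemma resolvent_solution_exists:
  assumes g: "sq_summable g" and cd: "solves z g c d"
  shows "\<exists>(y, h)\<in>L. \<forall>t\<in>T. h t - z * y t = g t"
proof -
  have "\<kappa> * c + (\<Sum>\<^sub>\<infinity>t\<in>T. of_real (m t) * (free_part z g c d t * cnj (b t))) = 0"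
    unfolding free_part_pairing[OF g] using cd by (simp add: solves_def algebra_simps)
  with sq_summable_mult_free_part[OF g] obtain y h where yh: "(y, h) \<in> L"
      "\<And>t. t \<in> T \<Longrightarrow> y t = free_part z g c d t + c * (a t / of_real t)"
      "\<And>t. t \<in> T \<Longrightarrow> h t = of_real t * free_part z g c d t"
    by (rule perturbation_graphI) blast
  moreover have "h t - z * y t = g t" if t: "t \<in> T" for t
    using resolvent_coordinate[OF t yh(2)[OF t] yh(3)[OF t], of z "g t"] cd t
    by (auto simp: free_part_def solves_def split: if_splits)
  ultimately show ?thesis by blast
qed

lemma resolvent_functional_bound:
  assumes "sq_summable g"
  shows "norm (resolvent_functional z g) \<le> norm2 (\<lambda>t. b t / (of_real t - cnj z)) * norm2 g"
  unfolding resolvent_functional_def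
  using Cauchy_Schwarz_atomic[OF assms sq_summable_b_resolvent[of "cnj z"]]
  by (simp only: mult.commute[of "norm2 g"])

text \<open>The conditions form a triangular linear system for \<open>c\<close> and \<open>d\<close>.  Off \<open>T\<close> its only pivot is
\<open>G z\<close>; at a point \<open>s\<close> of \<open>T\<close> the pivots are \<open>a s\<close> and \<open>m s * cnj (b s)\<close>.  The right-hand sides are
built from the point evaluation at \<open>s\<close> and from the resolvent functional, which are bounded in
\<open>g\<close>, and so are the solutions.\<close>

lemma solution_unique_and_bounded:
  assumes ab: "\<forall>t\<in>T. a t \<noteq> 0 \<and> b t \<noteq> 0" and G: "z \<notin> of_real ` T \<Longrightarrow> G z \<noteq> 0"
  obtains C D K where "\<And>g c d. solves z g c d \<longleftrightarrow> c = C g \<and> d = D g"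
    and "\<And>g. sq_summable g \<Longrightarrow> norm (C g) \<le> K * norm2 g"
    and "\<And>g. sq_summable g \<Longrightarrow> norm (D g) \<le> K * norm2 g"
proof -
  let ?l = "resolvent_functional z"
  let ?\<beta> = "norm2 (\<lambda>t. b t / (of_real t - cnj z))"
  have linear: "u + x * v = 0 \<longleftrightarrow> x = - u / v" if "v \<noteq> 0" for u v x :: complex
    using that by (metis add.commute eq_divide_eq eq_neg_iff_add_eq_0)
  show thesis
  proof (cases "z \<in> of_real ` T")
    case True
    then obtain s where s: "s \<in> T" "z = of_real s" by auto
    define w where "w = of_real (m s) * cnj (b s)"
    have w: "w \<noteq> 0" and as: "a s \<noteq> 0"
      using ab s mass_pos[of s] by (auto simp: w_def)
    let ?C = "\<lambda>g. - g s / a s"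
    let ?D = "\<lambda>g. - (?l g + ?C g * G z) / w"
    let ?KC = "1 / (sqrt (m s) * norm (a s))"
    let ?KD = "(?\<beta> + ?KC * norm (G z)) / norm w"
    have C: "norm (?C g) \<le> ?KC * norm2 g" if "sq_summable g" for g
    proof -
      have "norm (?C g) = norm (g s) / norm (a s)" by (simp add: norm_divide)
      also have "\<dots> \<le> norm2 g / sqrt (m s) / norm (a s)"
        by (intro divide_right_mono value_le_norm2 that s) auto
      finally show ?thesis by simp
    qed
    have D: "norm (?D g) \<le> ?KD * norm2 g" if "sq_summable g" for g
    proof -
      have "norm (?D g) = norm (?l g + ?C g * G z) / norm w"
        by (simp only: norm_divide norm_minus_cancel)
      also have "\<dots> \<le> (norm (?l g) + norm (?C g * G z)) / norm w"
        by (intro divide_right_mono norm_triangle_ineq norm_ge_zero)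
      also have "\<dots> = (norm (?l g) + norm (?C g) * norm (G z)) / norm w"
        by (simp only: norm_mult)
      also have "\<dots> \<le> (?\<beta> * norm2 g + ?KC * norm2 g * norm (G z)) / norm w"
        by (intro divide_right_mono add_mono mult_right_mono resolvent_functional_bound C that) auto
      finally show ?thesis by (simp add: algebra_simps)
    qed
    have le: "x \<le> k * norm2 g \<Longrightarrow> k \<le> k' \<Longrightarrow> x \<le> k' * norm2 g" for x k k' g
      using mult_right_mono[OF _ norm2_nonneg, of k k' g] by linarith
    show thesis
    proof (rule that[of ?C ?D "max ?KC ?KD"])
      fix g c d
      have "solves z g c d \<longleftrightarrow> ?l g + c * G z + d * w = 0 \<and> g s + c * a s = 0"
        using s by (auto simp: solves_def point_weight_def w_def)
      also have "g s + c * a s = 0 \<longleftrightarrow> c = ?C g"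
        using as by (rule linear)
      also have "?l g + c * G z + d * w = 0 \<longleftrightarrow> d = - (?l g + c * G z) / w"
        using w by (rule linear)
      finally show "solves z g c d \<longleftrightarrow> c = ?C g \<and> d = ?D g" by auto
    next
      fix g assume g: "sq_summable g"
      show "norm (?C g) \<le> max ?KC ?KD * norm2 g"
        using C[OF g] by (rule le) simp
      show "norm (?D g) \<le> max ?KC ?KD * norm2 g"
        using D[OF g] by (rule le) simp
    qed
  next
    case False
    then have G0: "G z \<noteq> 0" by (rule G)
    show thesis
    proof (rule that[of "\<lambda>g. - ?l g / G z" "\<lambda>_. 0" "?\<beta> / norm (G z)"])
      fix g c d
      have "?l g + c * G z = 0 \<longleftrightarrow> c = - ?l g / G z"
        using G0 by (rule linear)
      then show "solves z g c d \<longleftrightarrow> c = - ?l g / G z \<and> d = 0"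
        using False by (auto simp: solves_def)
    next
      fix g assume g: "sq_summable g"
      show "norm (- ?l g / G z) \<le> ?\<beta> / norm (G z) * norm2 g"
        using divide_right_mono[OF resolvent_functional_bound[OF g, of z], of "norm (G z)"]
        by (simp add: norm_divide)
      show "norm (0 :: complex) \<le> ?\<beta> / norm (G z) * norm2 g"
        by (simp add: norm2_nonneg)
    qed
  qed
qed

text \<open>Every solution is \<open>g / (x - z) + c * A + d * e\<close> with fixed square summable functions \<open>A\<close>, \<open>e\<close> and
scalars \<open>c\<close>, \<open>d\<close> that are bounded functionals of \<open>g\<close>; this gives uniqueness and boundedness.\<close>

lemma resolvent_setI:
  assumes ab: "\<forall>t\<in>T. a t \<noteq> 0 \<and> b t \<noteq> 0" and G: "z \<notin> of_real ` T \<Longrightarrow> G z \<noteq> 0"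
  shows "z \<in> resolvent_set M L"
proof -
  obtain C D K where CD: "\<And>g c d. solves z g c d \<longleftrightarrow> c = C g \<and> d = D g"
    and C: "\<And>g. sq_summable g \<Longrightarrow> norm (C g) \<le> K * norm2 g"
    and D: "\<And>g. sq_summable g \<Longrightarrow> norm (D g) \<le> K * norm2 g"
    using solution_unique_and_bounded[OF ab G] by blast
  define S where "S g t = free_part z g (C g) (D g) t + C g * (a t / of_real t)" for g t
  have form: "y t = S (\<lambda>t. h t - z * y t) t" if "(y, h) \<in> L" "t \<in> T" for y h t
    using that(1) by (rule resolvent_solution_form[of _ _ z]) (use that(2) in \<open>auto simp: S_def CD\<close>)
  have "y t = y' t"
    if "(y, h) \<in> L" "(y', h') \<in> L" and eq: "\<forall>t\<in>T. h t - z * y t = h' t - z * y' t" and t: "t \<in> T"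
    for y h y' h' t
  proof -
    let ?g = "\<lambda>t. h t - z * y t" and ?g' = "\<lambda>t. h' t - z * y' t"
    have "solves z ?g c d \<longleftrightarrow> solves z ?g' c d" for c d
    proof -
      have "resolvent_functional z ?g = resolvent_functional z ?g'"
        unfolding resolvent_functional_def using eq by (intro infsum_cong) simp
      moreover have "?g (Re z) = ?g' (Re z)" if "z \<in> of_real ` T"
        using that eq by auto
      ultimately show ?thesis by (simp add: solves_def)
    qed
    then have "solves z ?g' (C ?g) (D ?g)" using CD by blast
    then have "C ?g = C ?g'" "D ?g = D ?g'" by (simp_all add: CD)
    moreover have "?g t = ?g' t" using eq t by blast
    ultimately have S: "S ?g t = S ?g' t" by (simp only: S_def free_part_def)
    have "y t = S ?g t" using that(1) t by (rule form)
    also note S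
    also have "S ?g' t = y' t" using that(2) t by (rule form[symmetric])
    finally show ?thesis .
  qed
  moreover have "\<exists>(y, h)\<in>L. \<forall>t\<in>T. h t - z * y t = g t" if "g \<in> L2_space M" for g
    using that by (intro resolvent_solution_exists[where c = "C g" and d = "D g"]) (simp_all add: L2_iff CD)
  moreover have "\<exists>k. \<forall>(y, h)\<in>L. L2_norm M y \<le> k * L2_norm M (\<lambda>x. h x - z * y x)"
  proof -
    obtain R where "R \<ge> 0" and R: "\<And>t. t \<in> T \<Longrightarrow> norm (1 / (of_real t - z)) \<le> R"
      using bounded_resolvent_factor by blast
    define A where "A t = z * (a t / of_real t / (of_real t - z)) + a t / of_real t" for t
    define e where "e t = (if of_real t = z then 1 else 0 :: complex)" for t :: real
    have A: "sq_summable A"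
      unfolding A_def by (intro sq_summable_add sq_summable_cmult sq_summable_mult_resolvent sq_summable_a)
    have e: "sq_summable e"
      unfolding e_def by (rule sq_summable_at_single_point)
    let ?k = "2 * (2 * (R + K * norm2 A) + K * norm2 e)"
    have "L2_norm M y \<le> ?k * L2_norm M (\<lambda>x. h x - z * y x)" if yh: "(y, h) \<in> L" for y h
    proof -
      define g where "g t = h t - z * y t" for t
      have L2: "y \<in> L2_space M" "h \<in> L2_space M"
        using yh by (auto elim: perturbation_graphE)
      then have gL2: "g \<in> L2_space M"
        unfolding g_def[abs_def] by (rule L2_residual)
      then have g: "sq_summable g" by (simp add: L2_iff)
      have "norm (g t / (of_real t - z)) \<le> R * norm (g t)" if "t \<in> T" for t
        using mult_right_mono[OF R[OF that] norm_ge_zero[of "g t"]] by (simp add: norm_divide)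
      then have Rg: "sq_summable (\<lambda>t. g t / (of_real t - z))"
          "norm2 (\<lambda>t. g t / (of_real t - z)) \<le> R * norm2 g"
        by (blast intro: sq_summable_bound[OF g \<open>R \<ge> 0\<close>] norm2_bound[OF g \<open>R \<ge> 0\<close>])+
      have scaled: "norm2 (\<lambda>t. w * f t) \<le> K * norm2 g * norm2 f"
        if "sq_summable f" "norm w \<le> K * norm2 g" for w f
      proof -
        have "norm2 (\<lambda>t. w * f t) \<le> norm w * norm2 f"
          using that(1) by (rule norm2_bound) (simp_all add: norm_mult)
        also have "\<dots> \<le> K * norm2 g * norm2 f"
          using that(2) norm2_nonneg by (rule mult_right_mono)
        finally show ?thesis .
      qed
      have "norm2 y = norm2 (\<lambda>t. g t / (of_real t - z) + C g * A t + D g * e t)"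
        using form[OF yh, folded g_def]
        by (intro norm2_cong) (simp add: S_def free_part_def A_def e_def algebra_simps)
      also have "\<dots> \<le> 2 * (norm2 (\<lambda>t. g t / (of_real t - z) + C g * A t) + norm2 (\<lambda>t. D g * e t))"
        by (intro norm2_add sq_summable_add sq_summable_cmult Rg A e)
      also have "\<dots> \<le> 2 * (2 * (norm2 (\<lambda>t. g t / (of_real t - z)) + norm2 (\<lambda>t. C g * A t)) + norm2 (\<lambda>t. D g * e t))"
        using norm2_add[OF Rg(1) sq_summable_cmult[OF A, of "C g"]] by simp
      also have "\<dots> \<le> 2 * (2 * (R * norm2 g + K * norm2 g * norm2 A) + K * norm2 g * norm2 e)"
        by (intro mult_left_mono add_mono Rg(2) scaled A e C D g zero_le_numeral)
      also have "\<dots> = ?k * norm2 g" by (simp add: algebra_simps)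
      finally show ?thesis
        using L2_norm_eq[OF L2(1)] L2_norm_eq[OF gL2] by (simp add: g_def[abs_def])
    qed
    then show ?thesis by blast
  qed
  ultimately show ?thesis
    unfolding resolvent_set_def AE_M_iff by blast
qed

end

text \<open>The coefficients \<open>c = m * a * cnj b\<close> are distributed so that \<open>m * \<bar>a\<bar>\<^sup>2 = q\<close> and
\<open>m * \<bar>b\<bar>\<^sup>2 = \<bar>c\<bar>\<^sup>2 / q\<close> with a weight \<open>q \<ge> \<bar>c\<bar>\<close>.  Then \<open>b / x\<close> is square summable because
\<open>\<bar>c\<bar>\<^sup>2 / q \<le> \<bar>c\<bar>\<close>.  The simplest choice \<open>q = \<bar>c\<bar>\<close> could put \<open>a\<close> into \<open>L\<^sup>2\<close>, where a particular
\<open>\<kappa>\<close> is forbidden; adding the indicator function of a sparse infinite set excludes that and keeps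
\<open>a / x\<close> square summable.\<close>

lemma (in atomic_spectrum) admits_zero_free_series_imp_removable:
  assumes "admits_zero_free_series T"
  shows "removable T m"
proof -
  obtain c \<kappa> where c: "\<forall>t\<in>T. c t \<noteq> 0" "(\<lambda>t. norm (c t) / t\<^sup>2) summable_on T"
    and G: "\<And>z. z \<notin> of_real ` T \<Longrightarrow> pole_series T c \<kappa> z \<noteq> 0"
    using assms unfolding admits_zero_free_series_def by blast
  obtain N where N: "N \<subseteq> T" "infinite N" "(\<lambda>t. 1 / t\<^sup>2) summable_on N"
    using ex_sparse_subset by blast
  define q where "q t = norm (c t) + indicator N t" for t
  define a where "a t = (if t \<in> T then of_real (sqrt (q t / m t)) else 0 :: complex)" for t
  define b where "b t = (if t \<in> T then cnj (c t) / of_real (sqrt (q t * m t)) else 0 :: complex)" for t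
  have q: "q t \<ge> norm (c t)" "q t > 0" if "t \<in> T" for t
    using c(1) that by (auto simp: q_def indicator_def add_pos_nonneg)
  have a_sq: "m t * (norm (a t))\<^sup>2 = q t" if "t \<in> T" for t
    using q[OF that] mass_pos[OF that] that by (simp add: a_def)
  have b_sq: "m t * (norm (b t))\<^sup>2 = (norm (c t))\<^sup>2 / q t" if "t \<in> T" for t
    using q[OF that] mass_pos[OF that] that by (simp add: b_def norm_divide power_divide)
  have ab: "of_real (m t) * (a t * cnj (b t)) = c t" if "t \<in> T" for t
  proof -
    have "sqrt (q t * m t) = m t * sqrt (q t / m t)"
      using q[OF that] mass_pos[OF that] by (simp add: real_sqrt_mult real_sqrt_divide field_simps)
    moreover have "sqrt (q t / m t) > 0" "m t > 0" using q[OF that] mass_pos[OF that] by simp_all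
    ultimately show ?thesis using that q[OF that] by (simp add: a_def b_def)
  qed
  have "(\<lambda>t. norm (c t) / t\<^sup>2 + indicator N t / t\<^sup>2) summable_on T"
  proof (rule summable_on_add[OF c(2)])
    have "(\<lambda>t. indicator N t / t\<^sup>2) summable_on T \<longleftrightarrow> (\<lambda>t. 1 / t\<^sup>2) summable_on N"
      using N(1) by (intro summable_on_cong_neutral) auto
    then show "(\<lambda>t. indicator N t / t\<^sup>2) summable_on T" using N(3) by simp
  qed
  also have "?this \<longleftrightarrow> (\<lambda>t. m t * (norm (a t / of_real t))\<^sup>2) summable_on T"
  proof (rule summable_on_cong)
    fix t assume "t \<in> T"
    have "m t * (norm (a t / of_real t))\<^sup>2 = m t * (norm (a t))\<^sup>2 / t\<^sup>2"
      by (simp add: norm_divide power_divide)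
    then show "norm (c t) / t\<^sup>2 + indicator N t / t\<^sup>2 = m t * (norm (a t / of_real t))\<^sup>2"
      unfolding a_sq[OF \<open>t \<in> T\<close>] q_def by (simp add: add_divide_distrib)
  qed
  finally have a_L2: "(\<lambda>t. a t / of_real t) \<in> L2_space M"
    by (auto simp: L2_iff sq_summable_def a_def intro!: measurable_off_T)
  have "(\<lambda>t. norm (m t * (norm (b t / of_real t))\<^sup>2)) summable_on T"
    using c(2)
  proof (rule Infinite_Sum.abs_summable_on_comparison_test')
    fix t assume t: "t \<in> T"
    have "m t * (norm (b t / of_real t))\<^sup>2 = (norm (c t))\<^sup>2 / q t / t\<^sup>2"
      using b_sq[OF t] by (simp add: norm_divide power_divide)
    also have "\<dots> \<le> norm (c t) / t\<^sup>2"
      using q[OF t] by (intro divide_right_mono)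
        (auto simp: divide_le_eq power2_eq_square intro: mult_left_mono)
    finally show "norm (m t * (norm (b t / of_real t))\<^sup>2) \<le> norm (c t) / t\<^sup>2"
      using mass_pos[OF t] by (simp add: abs_mult)
  qed
  then have "(\<lambda>t. m t * (norm (b t / of_real t))\<^sup>2) summable_on T"
    by (rule summable_on_iff_abs_summable_on_real[THEN iffD2])
  then have b_L2: "(\<lambda>t. b t / of_real t) \<in> L2_space M"
    by (auto simp: L2_iff sq_summable_def b_def intro!: measurable_off_T)
  interpret rank_one_data T m a b \<kappa>
    using a_L2 b_L2 by unfold_locales
  have "a \<notin> L2_space M"
  proof
    assume "a \<in> L2_space M"
    then have "q summable_on T"
      using a_sq by (simp add: L2_iff sq_summable_def cong: summable_on_cong)
    then have "q summable_on N" using N(1) by (rule summable_on_subset_banach)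
    then have "(\<lambda>t. norm (1::real)) summable_on N"
      by (rule Infinite_Sum.abs_summable_on_comparison_test') (auto simp: q_def)
    then show False
      using infsum_diverge_constant[OF N(2), of "1::real"] by simp
  qed
  then have "perturbation_data M a b \<kappa>"
    using a_L2 b_L2 by (simp add: perturbation_data_def)
  moreover have "z \<in> resolvent_set M L" for z
  proof (rule resolvent_setI)
    show "\<forall>t\<in>T. a t \<noteq> 0 \<and> b t \<noteq> 0"
      using ab c(1) by fastforce
    show "pole_series T coupling \<kappa> z \<noteq> 0" if "z \<notin> of_real ` T"
    proof -
      have "pole_series T coupling \<kappa> z = pole_series T c \<kappa> z"
        unfolding pole_series_def by (simp add: coupling_def ab cong: infsum_cong)
      then show ?thesis using G[OF that] by simp
    qed
  qed
  ultimately show ?thesis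
    unfolding removable_def spectrum_def by (intro exI[of _ a] exI[of _ b] exI[of _ \<kappa>]) auto
qed

section \<open>Adding and exchanging finitely many points\<close>

lemma discrete_spectrum_insert:
  assumes "discrete_spectrum T" "s \<noteq> 0"
  shows "discrete_spectrum (insert s T)"
proof -
  interpret discrete_spectrum T by fact
  show ?thesis
  proof
    fix R
    have "{t \<in> insert s T. \<bar>t\<bar> \<le> R} \<subseteq> insert s {t \<in> T. \<bar>t\<bar> \<le> R}" by auto
    then show "finite {t \<in> insert s T. \<bar>t\<bar> \<le> R}"
      using finite_bounded_part by (meson finite_insert finite_subset)
  qed (use infinite_T nonzero_T assms(2) in auto)
qed

lemma discrete_spectrum_remove:
  assumes "discrete_spectrum T"
  shows "discrete_spectrum (T - {d})"
proof -
  interpret discrete_spectrum T by fact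
  show ?thesis
  proof
    show "finite {t \<in> T - {d}. \<bar>t\<bar> \<le> R}" for R
      using finite_bounded_part[of R] by (rule rev_finite_subset) auto
  qed (use infinite_T nonzero_T in auto)
qed

lemma admits_zero_free_series_union:
  assumes "finite S" "discrete_spectrum T" "admits_zero_free_series T" "0 \<notin> S" "S \<inter> T = {}"
  shows "discrete_spectrum (T \<union> S) \<and> admits_zero_free_series (T \<union> S)"
  using assms
proof (induction S)
  case (insert s S)
  then have IH: "discrete_spectrum (T \<union> S)" "admits_zero_free_series (T \<union> S)" by auto
  then have "discrete_spectrum (insert s (T \<union> S))" "admits_zero_free_series (insert s (T \<union> S))"
    using insert by (auto intro: discrete_spectrum_insert discrete_spectrum.admits_zero_free_series_insert)
  then show ?case by simp
qed auto

text \<open>The points are exchanged one by one; each intermediate set is again discrete and admits a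
zero-free series, and the remaining new points stay outside it.\<close>

lemma admits_zero_free_series_replace:
  assumes "finite D" "finite S" "card S = card D" "D \<subseteq> T"
    and "discrete_spectrum T" "admits_zero_free_series T" "0 \<notin> S" "S \<inter> T = {}"
  shows "discrete_spectrum ((T - D) \<union> S) \<and> admits_zero_free_series ((T - D) \<union> S)"
  using assms
proof (induction D arbitrary: S T)
  case (insert d D)
  then obtain s S' where S: "S = insert s S'" "s \<notin> S'" "finite S'" "card S' = card D"
    by (metis card_Suc_eq card_insert_disjoint finite_insert)
  let ?T = "insert s (T - {d})"
  have "discrete_spectrum ?T"
    using insert.prems S by (intro discrete_spectrum_insert discrete_spectrum_remove) auto
  moreover have "admits_zero_free_series ?T"
    using insert.prems S by (intro discrete_spectrum.admits_zero_free_series_exchange) auto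
  ultimately have "discrete_spectrum ((?T - D) \<union> S') \<and> admits_zero_free_series ((?T - D) \<union> S')"
    using insert.prems insert.hyps S by (intro insert.IH) auto
  moreover have "(?T - D) \<union> S' = (T - insert d D) \<union> S"
    using insert.prems S by auto
  ultimately show ?case by simp
qed auto

lemma discrete_spectrum_range:
  fixes t :: "nat \<Rightarrow> real"
  assumes "inj t" "\<forall>n. t n \<noteq> 0" "filterlim (\<lambda>n. \<bar>t n\<bar>) at_top sequentially"
  shows "discrete_spectrum (range t)"
proof
  show "infinite (range t)" using assms(1) finite_imageD by blast
  show "0 \<notin> range t" using assms(2) by auto
  fix R
  obtain N where N: "\<And>n. n \<ge> N \<Longrightarrow> R < \<bar>t n\<bar>"
    using assms(3) by (auto simp: filterlim_at_top_dense eventually_sequentially)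
  have "{x \<in> range t. \<bar>x\<bar> \<le> R} \<subseteq> t ` {..<N}"
    using N by (force simp: not_le[symmetric])
  then show "finite {x \<in> range t. \<bar>x\<bar> \<le> R}" by (rule finite_subset) simp
qed

lemma removable_iff_admits_zero_free_series:
  assumes "discrete_spectrum T" "\<forall>t\<in>T. 0 < m t"
  shows "removable T m \<longleftrightarrow> admits_zero_free_series T"
proof -
  interpret atomic_spectrum T m
    using assms by (simp add: atomic_spectrum_def atomic_spectrum_axioms_def)
  show ?thesis
    using removable_imp_admits_zero_free_series admits_zero_free_series_imp_removable by blast
qed

theorem corollary5p2:
  fixes t :: "nat \<Rightarrow> real" and m :: "real \<Rightarrow> real"
  assumes "inj t"
    and "\<forall>n. t n \<noteq> 0"
    and "filterlim (\<lambda>n. \<bar>t n\<bar>) at_top sequentially"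
    and "\<forall>x\<in>range t. 0 < m x"
    and "removable (range t) m"
  shows "(\<forall>S m'. finite S \<and> 0 \<notin> S \<and> S \<inter> range t = {} \<and> (\<forall>x\<in>range t \<union> S. 0 < m' x)
            \<longrightarrow> removable (range t \<union> S) m') \<and>
         (\<forall>D S m'. finite D \<and> D \<subseteq> range t \<and> finite S \<and> card S = card D \<and>
              0 \<notin> S \<and> S \<inter> range t = {} \<and> (\<forall>x\<in>(range t - D) \<union> S. 0 < m' x)
            \<longrightarrow> removable ((range t - D) \<union> S) m')"
proof -
  have T: "discrete_spectrum (range t)"
    using assms(1-3) by (rule discrete_spectrum_range)
  then have Z: "admits_zero_free_series (range t)"
    using assms(4,5) removable_iff_admits_zero_free_series by blast
  show ?thesis
    using admits_zero_free_series_union[OF _ T Z] admits_zero_free_series_replace[OF _ _ _ _ T Z]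
    by (simp add: removable_iff_admits_zero_free_series)
qed

end
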